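(* Let $f(x)=\sum_{j=0}^{s} c_j e^{\lambda_j x}$, where $c_0,\dots,c_s\in\mathbb{C}\setminus\{0\}$ and $\lambda_0,\dots,\lambda_s\in\mathbb{C}$ are distinct, ordered such that $\operatorname{Im}(\lambda_0)=\min_{0\le j\le s}\operatorname{Im}(\lambda_j)$. Let $n=\dim_{\mathbb{Q}}\{\operatorname{Im}(\lambda_1-\lambda_0),\dots,\operatorname{Im}(\lambda_s-\lambda_0)\}$. If $f$ is real-rooted, then there exist a Lee-Yang polynomial $p\in\mathbb{C}[z_1,\dots,z_n]$ and a vector $\boldsymbol{\ell}=(\ell_1,\dots,\ell_n)\in\mathbb{R}_+^n$ whose entries are $\mathbb{Q}$-linearly independent such that $$f(x)=e^{\lambda_0 x}\,p(\exp(ix\boldsymbol{\ell}))\quad\text{for all } x\in\mathbb{C}.$$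
   Context: $\mathbb{R}_+=\{x\in\mathbb{R}:x>0\}$. For real numbers $\omega_1,\dots,\omega_s$, $\dim_{\mathbb{Q}}\{\omega_1,\dots,\omega_s\}$ denotes the dimension of their $\mathbb{Q}$-linear span as a $\mathbb{Q}$-vector space. For $\mathbf{z}=(z_1,\dots,z_n)\in\mathbb{C}^n$, $\exp(\mathbf{z})=(e^{z_1},\dots,e^{z_n})$; thus $\exp(ix\boldsymbol{\ell})=(e^{ix\ell_1},\dots,e^{ix\ell_n})$. A function $f:\mathbb{C}\to\mathbb{C}$ is real-rooted if every $z\in\mathbb{C}$ with $f(z)=0$ has imaginary part zero. A polynomial $p\in\mathbb{C}[z_1,\dots,z_n]$ is a Lee-Yang polynomial if it has no zeros in $\Omega^n$ for both $\Omega=\mathbb{D}=\{z\in\mathbb{C}:|z|<1\}$ and $\Omega=\{z\in\mathbb{C}:|z|>1\}$. *)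

theory Defs
  imports Complex_Main "HOL-Library.Poly_Mapping" "HOL-Library.FuncSet"
begin

text \<open>
  The reals as a vector space over the rationals; this provides \<open>rat_real.dim\<close> and
  \<open>rat_real.independent\<close>.
\<close>

interpretation rat_real: vector_space "\<lambda>(q::rat) (x::real). of_rat q * x"
  by unfold_locales (simp_all add: algebra_simps of_rat_add of_rat_mult)

text \<open>
  Polynomials over the complex numbers in the variables \<open>z 0, z 1, \<dots>\<close>, as finitely supported
  maps from monomials (finitely supported exponent vectors) to coefficients. The ring structure is
  the convolution ring of \<open>HOL-Library.Poly_Mapping\<close>.
\<close>

type_synonym cmpoly = "(nat \<Rightarrow>\<^sub>0 nat) \<Rightarrow>\<^sub>0 complex"

text \<open>
  The paper's \<open>z\<^sub>1, \<dots>, z\<^sub>n\<close> are the variables with indices \<open>0, \<dots>, n - 1\<close>.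
\<close>

definition cmpolys :: "nat \<Rightarrow> cmpoly set" where
  "cmpolys n = {p. \<forall>m \<in> Poly_Mapping.keys p. Poly_Mapping.keys m \<subseteq> {..<n}}"

definition cmpoly_eval :: "cmpoly \<Rightarrow> (nat \<Rightarrow> complex) \<Rightarrow> complex" where
  "cmpoly_eval p z =
     (\<Sum>m \<in> Poly_Mapping.keys p. Poly_Mapping.lookup p m *
        (\<Prod>i \<in> Poly_Mapping.keys m. z i ^ Poly_Mapping.lookup m i))"

text \<open>
  For \<open>n = 0\<close> the set \<open>\<Omega>\<^sup>n\<close> is a singleton, so the Lee-Yang polynomials in no variables are the
  nonzero constants.
\<close>

definition lee_yang :: "nat \<Rightarrow> cmpoly \<Rightarrow> bool" where
  "lee_yang n p \<longleftrightarrow> p \<in> cmpolys n \<and>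
     (\<forall>\<Omega> \<in> {{z. cmod z < 1}, {z. cmod z > 1}}. \<forall>z \<in> {..<n} \<rightarrow>\<^sub>E \<Omega>. cmpoly_eval p z \<noteq> 0)"

definition real_rooted :: "(complex \<Rightarrow> complex) \<Rightarrow> bool" where
  "real_rooted f \<longleftrightarrow> (\<forall>z. f z = 0 \<longrightarrow> Im z = 0)"

end

theory Submission
  imports Defs "HOL-Complex_Analysis.Complex_Analysis" "HOL-Analysis.Kronecker_Approximation_Theorem"
begin

text \<open>
  A real-rooted exponential sum has all its frequencies on one vertical line, since otherwise it would
  have zeros near a ray that is not real. So \<open>f x = exp (lam 0 * x) * (\<Sum>j. c j * exp (\<i> * \<mu> j * x))\<close> with real
  \<open>\<mu> j \<ge> 0\<close>. Let \<open>\<mu> K\<close> be the largest frequency and choose a rational basis \<open>l > 0\<close> of the span of the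
  \<open>\<mu> j\<close> in which all \<open>\<mu> j\<close> (\<open>j \<noteq> 0\<close>) and all \<open>\<mu> K - \<mu> j\<close> (\<open>j \<noteq> K\<close>) have positive integer coordinates. The
  coordinates of the \<open>\<mu> j\<close> are the exponents of \<open>p\<close>.

  By Kronecker's and Hurwitz' theorems \<open>p\<close> does not vanish where \<open>(ln \<bar>z\<^sub>1\<bar>, \<dots>, ln \<bar>z\<^sub>n\<bar>)\<close> is a nonzero multiple
  of \<open>l\<close>. As \<open>0\<close> is strictly the smallest exponent vector of \<open>p\<close>, a homotopy extends this from the ray
  of negative multiples of \<open>l\<close> to the whole negative orthant, that is, to the polydisc. The exterior
  is the same statement for the reversed polynomial.
\<close>

section \<open>Exponential sums\<close>

lemma exp_sum_has_field_derivative: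
  fixes c b :: "'a \<Rightarrow> complex"
  shows "((\<lambda>x. \<Sum>j\<in>J. c j * exp (b j * x)) has_field_derivative
           (\<Sum>j\<in>J. c j * b j * exp (b j * x))) (at x)"
  by (auto intro!: derivative_eq_intros sum.cong simp: mult_ac)

lemma exp_sum_deriv_eq_0:
  fixes c b :: "'a \<Rightarrow> complex"
  assumes "open S" "\<And>x. x \<in> S \<Longrightarrow> (\<Sum>j\<in>J. c j * exp (b j * x)) = K" "x \<in> S"
  shows "(\<Sum>j\<in>J. c j * b j * exp (b j * x)) = 0"
proof -
  have "((\<lambda>x. \<Sum>j\<in>J. c j * exp (b j * x)) has_field_derivative 0) (at x)"
    by (rule has_field_derivative_transform_within_open[where f = "\<lambda>_. K" and S = S])
       (use assms in auto)
  with exp_sum_has_field_derivative show ?thesis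
    by (rule DERIV_unique)
qed

text \<open>Induction on the number of terms: multiplying by \<open>exp (- b a * x)\<close> makes
  the term of \<open>a\<close> constant, and differentiating removes it. The induction hypothesis
  then applies to the coefficients \<open>c j * (b j - b a)\<close>, whose second factor is nonzero
  by injectivity.\<close>

lemma exp_sum_eq_0_imp_coeff_eq_0:
  fixes c b :: "'a \<Rightarrow> complex"
  assumes "finite J" "inj_on b J" and S: "open S" "S \<noteq> {}"
    and "\<And>x. x \<in> S \<Longrightarrow> (\<Sum>j\<in>J. c j * exp (b j * x)) = 0" and "j \<in> J"
  shows "c j = 0"
  using assms(1,2,5,6)
proof (induction J arbitrary: c b j rule: finite_induct)
  case (insert a F)
  have eq: "(\<Sum>j\<in>F. c j * exp ((b j - b a) * x)) = - c a" if "x \<in> S" for x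
  proof -
    have "(\<Sum>j\<in>F. c j * exp ((b j - b a) * x)) + c a
        = exp (- b a * x) * (\<Sum>j\<in>insert a F. c j * exp (b j * x))"
      using insert.hyps by (simp add: sum_distrib_left algebra_simps exp_diff exp_minus divide_inverse)
    also have "\<dots> = 0" using insert.prems(2)[OF that] by simp
    finally show ?thesis by (simp add: add_eq_0_iff2)
  qed
  have F0: "c j = 0" if "j \<in> F" for j
  proof -
    have "c j * (b j - b a) = 0"
    proof (rule insert.IH[OF _ _ that, where b = "\<lambda>j. b j - b a"])
      show "inj_on (\<lambda>j. b j - b a) F"
        using insert.prems(1) by (auto simp: inj_on_def)
      show "(\<Sum>j\<in>F. c j * (b j - b a) * exp ((b j - b a) * x)) = 0" if "x \<in> S" for x
        by (rule exp_sum_deriv_eq_0[OF S(1) eq that])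
    qed
    moreover have "b j \<noteq> b a"
      using insert.prems(1) insert.hyps that by (auto simp: inj_on_def)
    ultimately show ?thesis by simp
  qed
  obtain x where "x \<in> S" using S by auto
  with insert.prems(2)[of x] insert.hyps F0 have "c a = 0" by simp
  with F0 insert.prems show ?case by auto
qed auto

lemma exp_sum_eq_const_imp:
  fixes c b :: "'a \<Rightarrow> complex"
  assumes "finite J" "inj_on b J" "open S" "S \<noteq> {}"
    and "\<And>x. x \<in> S \<Longrightarrow> (\<Sum>j\<in>J. c j * exp (b j * x)) = K" and "j \<in> J"
  shows "c j * b j = 0"
  by (rule exp_sum_eq_0_imp_coeff_eq_0[OF assms(1-4) _ assms(6), where c = "\<lambda>j. c j * b j"])
     (rule exp_sum_deriv_eq_0[OF assms(3,5)])

section \<open>Entire functions of linear growth and zeros of exponential sums\<close>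

text \<open>Borel-Caratheodory turns the one-sided bound on the real part into a linear bound on the
  modulus, and Liouville's theorem for polynomial growth leaves degree at most 1.\<close>

lemma entire_affine_if_Re_le:
  assumes L: "L holomorphic_on UNIV" and le: "\<And>z. Re (L z) \<le> A + B * cmod z"
  obtains a b where "\<And>z. L z = a + b * z"
proof -
  define L0 where "L0 = (\<lambda>z. L z - L 0)"
  \<comment> \<open>The summand 1 makes the bound on \<open>Re (L0 z)\<close> strict; together with
    \<open>B' \<ge> 0\<close> it also makes the constant \<open>M\<close> below positive.\<close>
  define A' B' where "A' = \<bar>A\<bar> + \<bar>Re (L 0)\<bar> + 1" and "B' = \<bar>B\<bar>"
  have holL0: "L0 holomorphic_on UNIV"
    unfolding L0_def by (intro holomorphic_intros L)
  have Re_L0: "Re (L0 z) < A' + B' * cmod z" for z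
    using le[of z] mult_right_mono[of B "\<bar>B\<bar>" "cmod z"]
    unfolding L0_def A'_def B'_def minus_complex.sel by (smt (verit) norm_ge_zero)
  have bound: "cmod (L0 z) \<le> (2 * A' + 4 * B') * cmod z ^ 1" if z: "1 \<le> cmod z" for z
  proof -
    have "z \<noteq> 0" using z by auto
    \<comment> \<open>Borel--Caratheodory: \<open>L0 / (2 M - L0)\<close> maps the disc of radius \<open>R\<close> into the unit disc.\<close>
    define R where "R = 2 * cmod z"
    define M where "M = A' + B' * R"
    define \<phi> where "\<phi> = (\<lambda>w. L0 (of_real R * w) / (2 * of_real M - L0 (of_real R * w)))"
    have "R > 0" using \<open>z \<noteq> 0\<close> by (simp add: R_def)
    hence "M > 0" unfolding M_def A'_def B'_def
      by (smt (verit) mult_nonneg_nonneg)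
    have lt: "Re (L0 (of_real R * w)) < M" if "cmod w < 1" for w
    proof -
      have "B' * cmod (of_real R * w) \<le> B' * R"
        using that \<open>R > 0\<close> by (intro mult_left_mono) (auto simp: B'_def norm_mult)
      with Re_L0[of "of_real R * w"] show ?thesis by (simp add: M_def)
    qed
    have ne: "2 * of_real M - L0 (of_real R * w) \<noteq> 0" if "cmod w < 1" for w
    proof
      assume "2 * of_real M - L0 (of_real R * w) = 0"
      hence "Re (L0 (of_real R * w)) = 2 * M" by (simp add: complex_eq_iff)
      with lt[OF that] \<open>M > 0\<close> show False by simp
    qed
    \<comment> \<open>Points left of the line \<open>Re x = M\<close> are closer to 0 than to its
      mirror image \<open>2 * M\<close>.\<close>
    have sq: "cmod x < cmod (2 * of_real M - x)" if "Re x < M" for x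
    proof -
      have "(cmod (2 * of_real M - x))\<^sup>2 - (cmod x)\<^sup>2 = 4 * M * (M - Re x)"
        unfolding cmod_power2 by (simp add: power2_eq_square algebra_simps)
      also have "\<dots> > 0" using that \<open>M > 0\<close> by simp
      finally show ?thesis by (simp add: power_less_imp_less_base)
    qed
    \<comment> \<open>The factor 2 in \<open>R\<close> places \<open>z / R\<close> at modulus 1/2,
      so the Schwarz lemma gives \<open>2 * cmod (L0 z) \<le> cmod (2 * M - L0 z)\<close>, which can
      be solved for \<open>cmod (L0 z)\<close>.\<close>
    have w: "cmod (z / of_real R) = 1 / 2" "of_real R * (z / of_real R) = z"
      using \<open>z \<noteq> 0\<close> by (auto simp: norm_divide R_def)
    have "cmod (\<phi> (z / of_real R)) \<le> cmod (z / of_real R)"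
    proof (rule Schwarz_Lemma(1))
      have "(\<lambda>w. L0 (of_real R * w)) holomorphic_on ball 0 1"
        by (rule holomorphic_on_compose_gen[OF _ holL0, unfolded o_def]) (auto intro!: holomorphic_intros)
      then show "\<phi> holomorphic_on ball 0 1"
        unfolding \<phi>_def using ne by (intro holomorphic_intros) auto
      show "\<phi> 0 = 0" by (simp add: \<phi>_def L0_def)
      show "cmod (\<phi> w) < 1" if "cmod w < 1" for w
        using sq[OF lt[OF that]] ne[OF that] by (simp add: \<phi>_def norm_divide divide_simps)
    qed (simp add: w)
    hence "cmod (L0 z) / cmod (2 * of_real M - L0 z) \<le> 1 / 2"
      unfolding w(1) by (simp only: \<phi>_def w(2) norm_divide)
    moreover have "2 * of_real M - L0 z \<noteq> 0"
      using ne[of "z / of_real R"] by (simp only: w) simp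
    ultimately have "cmod (L0 z) \<le> cmod (2 * of_real M - L0 z) / 2"
      by (simp add: pos_divide_le_eq)
    also have "\<dots> \<le> (2 * M + cmod (L0 z)) / 2"
      using norm_triangle_ineq4[of "2 * of_real M" "L0 z"] \<open>M > 0\<close> by simp
    finally have "cmod (L0 z) \<le> 2 * M" by simp
    also have "\<dots> = 2 * A' + 4 * B' * cmod z" by (simp add: M_def R_def)
    also have "\<dots> \<le> (2 * A' + 4 * B') * cmod z"
      using mult_left_mono[OF z, of "2 * A'"] by (simp add: A'_def algebra_simps)
    finally show ?thesis by simp
  qed
  have "L z = L 0 + deriv L0 0 * z" for z
    using Liouville_polynomial[where A = 1, OF holL0 bound, of z] by (simp add: L0_def algebra_simps)
  with that show thesis by blast
qed

text \<open>A zero-free sum would have an entire logarithm. Its real part grows at most linearly, so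
  the logarithm is affine and the sum is a single exponential. Two distinct frequencies with nonzero
  coefficients contradict this.\<close>

lemma exp_sum_has_zero:
  fixes c b :: "'a \<Rightarrow> complex"
  assumes J: "finite J" "inj_on b J" and c: "\<And>j. j \<in> J \<Longrightarrow> c j \<noteq> 0"
    and ik: "i \<in> J" "k \<in> J" "i \<noteq> k"
  obtains x where "(\<Sum>j\<in>J. c j * exp (b j * x)) = 0"
proof (rule ccontr)
  assume "\<not> thesis"
  with that have nz: "(\<Sum>j\<in>J. c j * exp (b j * x)) \<noteq> 0" for x by blast
  have "(\<lambda>x. \<Sum>j\<in>J. c j * exp (b j * x)) holomorphic_on UNIV"
    by (intro holomorphic_intros)
  then obtain L where holL: "L holomorphic_on UNIV"
    and L: "\<And>x. exp (L x) = (\<Sum>j\<in>J. c j * exp (b j * x))"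
    using holomorphic_logarithm_exists[of UNIV "\<lambda>x. \<Sum>j\<in>J. c j * exp (b j * x)" 0] nz
    by (metis UNIV_I convex_UNIV open_UNIV)
  define B where "B = (\<Sum>j\<in>J. cmod (b j))"
  define C where "C = (\<Sum>j\<in>J. cmod (c j))"
  have "C > 0" unfolding C_def using J ik c by (intro sum_pos) auto
  have "Re (L z) \<le> ln C + B * cmod z" for z
  proof -
    have "exp (Re (L z)) = cmod (exp (L z))" by simp
    also have "\<dots> \<le> (\<Sum>j\<in>J. cmod (c j) * exp (Re (b j * z)))"
      unfolding L by (rule norm_sum[THEN order_trans]) (simp add: norm_mult)
    also have "\<dots> \<le> (\<Sum>j\<in>J. cmod (c j) * exp (B * cmod z))"
    proof (intro sum_mono mult_left_mono)
      fix j assume "j \<in> J"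
      have "Re (b j * z) \<le> cmod (b j) * cmod z"
        using complex_Re_le_cmod[of "b j * z"] by (simp only: norm_mult)
      also have "\<dots> \<le> B * cmod z"
        unfolding B_def using J \<open>j \<in> J\<close> by (intro mult_right_mono member_le_sum) auto
      finally show "exp (Re (b j * z)) \<le> exp (B * cmod z)" by simp
    qed auto
    also have "\<dots> = exp (ln C + B * cmod z)"
      using \<open>C > 0\<close> by (simp add: C_def exp_add sum_distrib_right)
    finally show ?thesis by simp
  qed
  then obtain a d where ad: "\<And>z. L z = a + d * z"
    using entire_affine_if_Re_le[OF holL] by metis
  have eq: "(\<Sum>j\<in>J. c j * exp ((b j - d) * x)) = exp a" for x
  proof -
    have "(\<Sum>j\<in>J. c j * exp ((b j - d) * x)) = exp (L x) * exp (- d * x)"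
      by (simp add: L sum_distrib_right left_diff_distrib exp_diff exp_minus divide_inverse mult.assoc)
    then show ?thesis by (simp add: ad exp_add exp_minus)
  qed
  have "inj_on (\<lambda>j. b j - d) J"
    using J(2) by (auto simp: inj_on_def)
  then have "c j * (b j - d) = 0" if "j \<in> J" for j
    by (rule exp_sum_eq_const_imp[OF J(1) _ open_UNIV UNIV_not_empty eq that])
  with c ik have "b i = d" "b k = d" by auto
  with J(2) ik show False by (auto dest: inj_onD)
qed

section \<open>Hurwitz' theorem for convergent families of exponential sums\<close>

lemma uniform_limit_sum:
  fixes f :: "'i \<Rightarrow> 'a \<Rightarrow> 'b \<Rightarrow> 'c::real_normed_vector"
  assumes "\<And>j. j \<in> J \<Longrightarrow> uniform_limit X (f j) (l j) F"
  shows "uniform_limit X (\<lambda>a x. \<Sum>j\<in>J. f j a x) (\<lambda>x. \<Sum>j\<in>J. l j x) F"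
  using assms
  by (induction J rule: infinite_finite_induct) (auto intro!: uniform_limit_intros)

lemma uniform_limit_exp_sum:
  fixes d \<beta> :: "nat \<Rightarrow> 'a \<Rightarrow> complex"
  assumes X: "compact X"
    and d: "\<And>j. j \<in> J \<Longrightarrow> (\<lambda>k. d k j) \<longlonglongrightarrow> d' j"
    and \<beta>: "\<And>j. j \<in> J \<Longrightarrow> (\<lambda>k. \<beta> k j) \<longlonglongrightarrow> \<beta>' j"
  shows "uniform_limit X (\<lambda>k x. \<Sum>j\<in>J. d k j * exp (\<beta> k j * x))
           (\<lambda>x. \<Sum>j\<in>J. d' j * exp (\<beta>' j * x)) sequentially"
proof (intro uniform_limit_sum uniform_lim_mult)
  fix j assume j: "j \<in> J"
  have const: "uniform_limit X (\<lambda>k _. g k) (\<lambda>_. l) sequentially" if "g \<longlonglongrightarrow> l"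
    for g :: "nat \<Rightarrow> complex" and l
    using that by (auto simp: uniform_limit_iff tendsto_iff eventually_mono)
  show "uniform_limit X (\<lambda>k _. d k j) (\<lambda>_. d' j) sequentially"
    by (rule const[OF d[OF j]])
  \<comment> \<open>Convergent frequencies are bounded and \<open>X\<close> is compact, so all
    exponents lie in one ball, where \<open>exp\<close> is uniformly continuous.\<close>
  obtain K where K: "\<And>k. cmod (\<beta> k j) \<le> K"
    using Bseq_def \<beta>[OF j] convergentI convergent_imp_Bseq by metis
  obtain R where R: "\<And>x. x \<in> X \<Longrightarrow> cmod x \<le> R"
    using compact_imp_bounded[OF X] by (auto simp: bounded_iff)
  show "uniform_limit X (\<lambda>k x. exp (\<beta> k j * x)) (\<lambda>x. exp (\<beta>' j * x)) sequentially"
  proof (rule uniform_limit_compose_uniformly_continuous_on[where f = exp and B = "cball 0 (K * R)"])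
    show "uniform_limit X (\<lambda>k x. \<beta> k j * x) (\<lambda>x. \<beta>' j * x) sequentially"
      by (intro uniform_lim_mult const[OF \<beta>[OF j]] uniform_limit_const
            compact_imp_bounded compact_continuous_image continuous_intros X)
    show "uniformly_continuous_on (cball 0 (K * R)) (exp :: complex \<Rightarrow> complex)"
      by (intro compact_uniformly_continuous continuous_intros) auto
    show "\<forall>\<^sub>F k in sequentially. \<forall>x\<in>X. \<beta> k j * x \<in> cball 0 (K * R)"
      using K R by (auto simp: norm_mult intro!: always_eventually mult_mono order_trans[OF norm_ge_zero K])
  qed auto
qed (intro compact_imp_bounded compact_continuous_image continuous_intros X)+

text \<open>Coefficients and frequencies may both vary with \<open>k\<close>. The point
  \<open>y\<close> excludes the zero function as a limit; a constant limit is treated apart because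
  \<open>Hurwitz_no_zeros\<close> concerns non-constant ones.\<close>

lemma exp_sum_Hurwitz:
  fixes d \<beta> :: "nat \<Rightarrow> 'a \<Rightarrow> complex"
  assumes S: "open S" "connected S"
    and d: "\<And>j. j \<in> J \<Longrightarrow> (\<lambda>k. d k j) \<longlonglongrightarrow> d' j"
    and \<beta>: "\<And>j. j \<in> J \<Longrightarrow> (\<lambda>k. \<beta> k j) \<longlonglongrightarrow> \<beta>' j"
    and nz: "\<And>k x. x \<in> S \<Longrightarrow> (\<Sum>j\<in>J. d k j * exp (\<beta> k j * x)) \<noteq> 0"
    and y: "y \<in> S" "(\<Sum>j\<in>J. d' j * exp (\<beta>' j * y)) \<noteq> 0"
    and "x \<in> S"
  shows "(\<Sum>j\<in>J. d' j * exp (\<beta>' j * x)) \<noteq> 0"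
proof (cases "(\<lambda>x. \<Sum>j\<in>J. d' j * exp (\<beta>' j * x)) constant_on S")
  case True
  then show ?thesis using y \<open>x \<in> S\<close> unfolding constant_on_def by metis
next
  case False
  show ?thesis
    by (rule Hurwitz_no_zeros[OF S _ _ uniform_limit_exp_sum[OF _ d \<beta>] False nz \<open>x \<in> S\<close>])
       (auto intro!: holomorphic_intros)
qed

section \<open>Directions of zeros\<close>

text \<open>Dirichlet's simultaneous approximation is applied to the numbers
  \<open>L * \<omega> j / (2 * pi)\<close>. Scaling by \<open>L\<close> beforehand turns the
  multiplier \<open>q \<ge> 1\<close> into a return time \<open>L * q\<close> of at least
  \<open>L\<close>, so the times tend to infinity.\<close>

lemma cis_simultaneous_recurrence:
  fixes \<omega> :: "'a \<Rightarrow> real"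
  assumes "finite T"
  obtains r :: "nat \<Rightarrow> real" where "\<And>k. r k \<ge> R" "filterlim r at_top sequentially"
    "\<And>j. j \<in> T \<Longrightarrow> (\<lambda>k. cis (\<omega> j * r k)) \<longlonglongrightarrow> 1"
proof -
  obtain h where h: "bij_betw h {0..<card T} T"
    using ex_bij_betw_nat_finite[OF assms] by blast
  have "\<forall>k. \<exists>r p. r \<ge> \<bar>R\<bar> + real k \<and>
      (\<forall>i<card T. \<bar>\<omega> (h i) * r - 2 * pi * of_int (p i)\<bar> \<le> 2 * pi / real (Suc k))"
  proof
    fix k
    define L where "L = \<bar>R\<bar> + real k"
    obtain q p where "0 < q" and
      qp: "\<And>i. i < card T \<Longrightarrow>
            \<bar>of_int q * (L * \<omega> (h i) / (2 * pi)) - of_int (p i)\<bar> < 1 / real (Suc k)"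
      by (rule Dirichlet_approx_simult[of "Suc k" "card T" "\<lambda>i. L * \<omega> (h i) / (2 * pi)"]) auto
    have "L * 1 \<le> L * of_int q"
      using \<open>0 < q\<close> by (intro mult_left_mono) (auto simp: L_def)
    moreover have "\<bar>\<omega> (h i) * (L * of_int q) - 2 * pi * of_int (p i)\<bar> \<le> 2 * pi / real (Suc k)"
      if "i < card T" for i
    proof -
      have "\<omega> (h i) * (L * of_int q) - 2 * pi * of_int (p i)
          = 2 * pi * (of_int q * (L * \<omega> (h i) / (2 * pi)) - of_int (p i))"
        by (simp add: field_simps)
      then have "\<bar>\<omega> (h i) * (L * of_int q) - 2 * pi * of_int (p i)\<bar>
          = 2 * pi * \<bar>of_int q * (L * \<omega> (h i) / (2 * pi)) - of_int (p i)\<bar>"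
        by (simp add: abs_mult)
      also have "\<dots> \<le> 2 * pi * (1 / real (Suc k))"
        using qp[OF that] by (intro mult_left_mono) auto
      finally show ?thesis by simp
    qed
    ultimately show "\<exists>r p. r \<ge> \<bar>R\<bar> + real k \<and>
        (\<forall>i<card T. \<bar>\<omega> (h i) * r - 2 * pi * of_int (p i)\<bar> \<le> 2 * pi / real (Suc k))"
      by (intro exI[of _ "L * of_int q"] exI[of _ p]) (simp add: L_def)
  qed
  then obtain r p where r: "\<And>k. r k \<ge> \<bar>R\<bar> + real k"
    and rp: "\<And>k i. i < card T \<Longrightarrow>
          \<bar>\<omega> (h i) * r k - 2 * pi * of_int (p k i)\<bar> \<le> 2 * pi / real (Suc k)"
    unfolding choice_iff by blast
  show thesis
  proof
    show "r k \<ge> R" for k using r[of k] by linarith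
    show "filterlim r at_top sequentially"
    proof (rule filterlim_at_top_mono[OF filterlim_real_sequentially])
      show "\<forall>\<^sub>F k in sequentially. real k \<le> r k"
        using r by (intro always_eventually allI) (smt (verit))
    qed
    show "(\<lambda>k. cis (\<omega> j * r k)) \<longlonglongrightarrow> 1" if j: "j \<in> T" for j
    proof -
      obtain i where i: "i < card T" "j = h i"
        using bij_betw_imp_surj_on[OF h] j by fastforce
      define y where "y = (\<lambda>k. \<omega> j * r k - 2 * pi * of_int (p k i))"
      have "y \<longlonglongrightarrow> 0"
      proof (rule Lim_null_comparison)
        show "\<forall>\<^sub>F k in sequentially. norm (y k) \<le> 2 * pi / real (Suc k)"
          using rp[OF i(1)] by (simp add: y_def i(2))
        have "(\<lambda>k. 2 * pi * inverse (real (Suc k))) \<longlonglongrightarrow> 2 * pi * 0"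
          by (intro tendsto_mult tendsto_const LIMSEQ_inverse_real_of_nat)
        then show "(\<lambda>k. 2 * pi / real (Suc k)) \<longlonglongrightarrow> 0"
          by (simp add: divide_inverse)
      qed
      then have "(\<lambda>k. cis (y k)) \<longlonglongrightarrow> cis 0"
        by (rule tendsto_cis)
      moreover have "cis (y k) = cis (\<omega> j * r k)" for k
        by (simp only: y_def cis_divide[symmetric] cis_multiple_2pi[OF Ints_of_int] div_by_1)
      ultimately show ?thesis by simp
    qed
  qed
qed

text \<open>The horizontal line through the lowest point \<open>b i\<close> is tilted on the side of
  \<open>b k\<close> until it meets another point. The sign \<open>s\<close> records the side,
  \<open>P\<close> collects the points strictly on that side, and \<open>t\<close> is the least
  slope from \<open>b i\<close> to one of them; \<open>u\<close> is an outer normal of the edge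
  found.\<close>

lemma exists_supporting_direction:
  fixes b :: "'a \<Rightarrow> complex"
  assumes J: "finite J" "i \<in> J" and min: "\<And>j. j \<in> J \<Longrightarrow> Im (b i) \<le> Im (b j)"
    and k: "k \<in> J" "Re (b k) \<noteq> Re (b i)"
  obtains u m where "Im u = 1" "m \<in> J" "m \<noteq> i" "Re ((b m - b i) * u) = 0"
    "\<And>j. j \<in> J \<Longrightarrow> Re ((b j - b i) * u) \<le> 0"
proof -
  define s where "s = sgn (Re (b k) - Re (b i))"
  define D where "D = (\<lambda>j. s * (Re (b j) - Re (b i)))"
  define q where "q = (\<lambda>j. (Im (b j) - Im (b i)) / D j)"
  define P where "P = {j \<in> J. D j > 0}"
  have "k \<in> P" using k by (simp add: P_def D_def s_def sgn_if)
  have "finite P" using J by (simp add: P_def)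
  define t where "t = Min (q ` P)"
  have "t \<in> q ` P" unfolding t_def using \<open>finite P\<close> \<open>k \<in> P\<close> by (intro Min_in) auto
  then obtain m where m: "m \<in> P" "t = q m" by auto
  have t: "t \<le> q j" if "j \<in> P" for j
    unfolding t_def using \<open>finite P\<close> that by (intro Min_le) auto
  have "t \<ge> 0" using m min by (auto simp: q_def P_def)
  define u where "u = Complex (s * t) 1"
  have Re_u: "Re ((b j - b i) * u) = t * D j - (Im (b j) - Im (b i))" for j
    by (simp add: u_def D_def algebra_simps)
  show thesis
  proof
    show "Im u = 1" by (simp add: u_def)
    show "m \<in> J" "m \<noteq> i" using m by (auto simp: P_def D_def)
    show "Re ((b m - b i) * u) = 0"
      unfolding Re_u using m by (simp add: q_def P_def)
    show "Re ((b j - b i) * u) \<le> 0" if "j \<in> J" for j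
    proof (cases "j \<in> P")
      case True
      then have "t * D j \<le> q j * D j"
        using t by (intro mult_right_mono) (auto simp: P_def)
      also have "\<dots> = Im (b j) - Im (b i)" using True by (simp add: q_def P_def)
      finally show ?thesis unfolding Re_u by simp
    next
      case False
      then have "t * D j \<le> 0"
        using \<open>t \<ge> 0\<close> that by (intro mult_nonneg_nonpos) (auto simp: P_def)
      then show ?thesis unfolding Re_u using min[OF that] by simp
    qed
  qed
qed

text \<open>
  If the real parts differ, an edge of the Newton polygon has an outer normal \<open>u\<close> with \<open>Im u > 0\<close>.
  Far out in direction \<open>u\<close> the sum looks like its edge part, which is almost periodic along \<open>u\<close>
  and has a zero; by Hurwitz' theorem this zero reappears in the upper half-plane.
\<close>

lemma Re_eq_if_exp_sum_nonzero_upper: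
  fixes c b :: "'a \<Rightarrow> complex"
  assumes J: "finite J" "inj_on b J" "i \<in> J" and c: "\<And>j. j \<in> J \<Longrightarrow> c j \<noteq> 0"
    and min: "\<And>j. j \<in> J \<Longrightarrow> Im (b i) \<le> Im (b j)"
    and nz: "\<And>x. Im x > 0 \<Longrightarrow> (\<Sum>j\<in>J. c j * exp (b j * x)) \<noteq> 0"
    and k: "k \<in> J"
  shows "Re (b k) = Re (b i)"
proof (rule ccontr)
  assume "Re (b k) \<noteq> Re (b i)"
  then obtain u m where u: "Im u = 1" and m: "m \<in> J" "m \<noteq> i" "Re ((b m - b i) * u) = 0"
    and le: "\<And>j. j \<in> J \<Longrightarrow> Re ((b j - b i) * u) \<le> 0"
    using exists_supporting_direction[of J i b k, OF J(1,3) min k] by blast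
  define \<delta> where "\<delta> = (\<lambda>j. b j - b i)"
  define T where "T = {j \<in> J. Re (\<delta> j * u) = 0}"
  have T: "finite T" "T \<subseteq> J" "i \<in> T" "m \<in> T"
    using J m by (auto simp: T_def \<delta>_def)
  have inj: "inj_on \<delta> J" using J(2) by (auto simp: \<delta>_def inj_on_def)
  have injT: "inj_on \<delta> T" using inj T(2) by (rule inj_on_subset)
  obtain x0 where x0: "(\<Sum>j\<in>T. c j * exp (\<delta> j * x0)) = 0"
    using exp_sum_has_zero[OF T(1) injT, of c i m] c T m by auto
  define R where "R = \<bar>Im x0\<bar> + 1"
  obtain r :: "nat \<Rightarrow> real" where r: "\<And>k. r k \<ge> R" "filterlim r at_top sequentially"
    "\<And>j. j \<in> T \<Longrightarrow> (\<lambda>k. cis (Im (\<delta> j * u) * r k)) \<longlonglongrightarrow> 1"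
    using cis_simultaneous_recurrence[OF T(1), of R "\<lambda>j. Im (\<delta> j * u)"] by blast
  \<comment> \<open>As \<open>Im u = 1\<close> and \<open>r k \<ge> R\<close>, translation by
    \<open>u * r k\<close> moves this half-plane into the upper half-plane; by the choice of
    \<open>R\<close> it contains \<open>x0\<close>.\<close>
  define S where "S = {x. Im x > - R}"
  have "x0 \<in> S" by (simp add: S_def R_def)
  then have S: "open S" "S \<noteq> {}" "x0 \<in> S"
    by (auto simp: S_def open_halfspace_Im_gt)
  \<comment> \<open>Up to an exponential factor, \<open>d k\<close> gives the coefficients of the
    sum translated by \<open>u * r k\<close>. Off the edge they decay to 0; on the edge
    \<open>\<delta> j * u\<close> is purely imaginary and recurrence brings them back to
    \<open>c j\<close>.\<close>
  define d where "d = (\<lambda>k j. c j * exp (\<delta> j * u * of_real (r k)))"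
  define d' where "d' = (\<lambda>j. if j \<in> T then c j else 0)"
  have sum_d': "(\<Sum>j\<in>J. d' j * exp (\<delta> j * x)) = (\<Sum>j\<in>T. c j * exp (\<delta> j * x))" for x
    by (rule sum.mono_neutral_cong_right) (use T J in \<open>auto simp: d'_def\<close>)
  have "\<exists>y\<in>S. (\<Sum>j\<in>J. d' j * exp (\<delta> j * y)) \<noteq> 0"
  proof (rule ccontr)
    assume "\<not> ?thesis"
    then have "c i = 0"
      using exp_sum_eq_0_imp_coeff_eq_0[OF T(1) injT S(1,2) _ T(3), of c] by (auto simp: sum_d')
    with c J show False by auto
  qed
  then obtain y where y: "y \<in> S" "(\<Sum>j\<in>J. d' j * exp (\<delta> j * y)) \<noteq> 0" by blast
  have "(\<Sum>j\<in>J. d' j * exp (\<delta> j * x0)) \<noteq> 0"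
  proof (rule exp_sum_Hurwitz[where d = d and \<beta> = "\<lambda>_. \<delta>", OF S(1) _ _ _ _ y S(3)])
    show "connected S"
      unfolding S_def by (intro convex_connected convex_halfspace_Im_gt)
    show "(\<lambda>k. d k j) \<longlonglongrightarrow> d' j" if "j \<in> J" for j
    proof (cases "j \<in> T")
      case True
      have "\<delta> j * u * of_real (r k) = \<i> * of_real (Im (\<delta> j * u) * r k)" for k
        using True by (auto simp: T_def complex_eq_iff)
      then have "d k j = c j * cis (Im (\<delta> j * u) * r k)" for k
        by (simp only: d_def cis_conv_exp)
      moreover have "(\<lambda>k. c j * cis (Im (\<delta> j * u) * r k)) \<longlonglongrightarrow> c j * 1"
        by (intro tendsto_intros r True)
      ultimately show ?thesis using True by (simp add: d'_def)
    next
      case False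
      then have neg: "Re (\<delta> j * u) < 0"
        using le[OF that] that by (auto simp: T_def \<delta>_def)
      have "(\<lambda>k. exp (\<delta> j * u * of_real (r k))) \<longlonglongrightarrow> 0"
      proof (rule tendsto_norm_zero_cancel)
        have "filterlim (\<lambda>k. Re (\<delta> j * u) * r k) at_bot sequentially"
          using neg r(2) by (rule filterlim_tendsto_neg_mult_at_bot[OF tendsto_const])
        then have "(\<lambda>k. exp (Re (\<delta> j * u) * r k)) \<longlonglongrightarrow> 0"
          by (rule filterlim_compose[OF exp_at_bot])
        then show "(\<lambda>k. cmod (exp (\<delta> j * u * of_real (r k)))) \<longlonglongrightarrow> 0"
          by simp
      qed
      then have "(\<lambda>k. d k j) \<longlonglongrightarrow> c j * 0"
        unfolding d_def by (intro tendsto_intros)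
      with False show ?thesis by (simp add: d'_def)
    qed
    show "(\<Sum>j\<in>J. d k j * exp (\<delta> j * x)) \<noteq> 0" if "x \<in> S" for k x
    proof -
      define x' where "x' = x + u * of_real (r k)"
      have "Im x' > 0" using that r(1)[of k] u by (simp add: x'_def S_def)
      have "(\<Sum>j\<in>J. d k j * exp (\<delta> j * x))
          = exp (- (b i * x')) * (\<Sum>j\<in>J. c j * exp (b j * x'))"
        unfolding sum_distrib_left
      proof (rule sum.cong)
        fix j
        have "exp (\<delta> j * u * of_real (r k)) * exp (\<delta> j * x) = exp (- (b i * x')) * exp (b j * x')"
          unfolding exp_add[symmetric] by (simp add: \<delta>_def x'_def algebra_simps)
        then show "d k j * exp (\<delta> j * x) = exp (- (b i * x')) * (c j * exp (b j * x'))"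
          by (simp add: d_def mult_ac)
      qed simp
      with nz[OF \<open>Im x' > 0\<close>] show ?thesis by simp
    qed
  qed auto
  with x0 sum_d' show False by simp
qed

section \<open>Rational bases with positive coordinates\<close>

lemma rat_common_denominator:
  fixes f :: "'a \<Rightarrow> rat"
  assumes "finite A"
  shows "\<exists>D::nat. D > 0 \<and> (\<forall>x\<in>A. \<exists>z::int. f x * of_nat D = of_int z)"
  using assms
proof (induction A rule: finite_induct)
  case empty
  show ?case by (intro exI[of _ 1]) auto
next
  case (insert a A)
  then obtain D where D: "D > 0" "\<And>x. x \<in> A \<Longrightarrow> \<exists>z::int. f x * of_nat D = of_int z"
    by auto
  obtain p q where pq: "f a = of_int p / of_int q" "q > 0"
    using quotient_of_div quotient_of_denom_pos by (metis prod.collapse)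
  have "f a * of_nat (D * nat q) = of_int (p * int D)"
    using pq by (simp add: of_nat_nat)
  moreover have "\<exists>z::int. f x * of_nat (D * nat q) = of_int z" if x: "x \<in> A" for x
  proof -
    obtain z :: int where "f x * of_nat D = of_int z" using D(2)[OF x] by blast
    then have "f x * of_nat (D * nat q) = of_int (z * q)"
      using pq by (simp add: of_nat_nat mult.assoc[symmetric])
    then show ?thesis by blast
  qed
  moreover have "D * nat q > 0" using D(1) pq(2) by simp
  ultimately show ?case by blast
qed

text \<open>A repeated or redundant vector would leave fewer than \<open>rat_real.dim M\<close>
  vectors whose span contains \<open>M\<close>.\<close>

lemma rat_independent_if_spanning:
  fixes l :: "nat \<Rightarrow> real"
  assumes M: "M \<subseteq> rat_real.span (l ` {..<n})" and n: "n = rat_real.dim M"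
  shows "inj_on l {..<n}" "rat_real.independent (l ` {..<n})"
proof -
  have "n \<le> card (l ` {..<n})"
    unfolding n by (rule rat_real.dim_le_card) (use M n in auto)
  then have card: "card (l ` {..<n}) = card {..<n}"
    using card_image_le[of "{..<n}" l] by simp
  then show "inj_on l {..<n}"
    by (intro eq_card_imp_inj_on) auto
  show "rat_real.independent (l ` {..<n})"
  proof
    assume "rat_real.dependent (l ` {..<n})"
    then obtain x where x: "x \<in> l ` {..<n}" "x \<in> rat_real.span (l ` {..<n} - {x})"
      unfolding rat_real.dependent_def by blast
    have "rat_real.span (l ` {..<n} - {x}) = rat_real.span (l ` {..<n})"
      using rat_real.span_redundant[OF x(2)] x(1) by (simp add: insert_absorb)
    with M have "rat_real.dim M \<le> card (l ` {..<n} - {x})"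
      by (intro rat_real.dim_le_card) auto
    also have "\<dots> < card (l ` {..<n})"
      using x(1) by (intro psubset_card_mono) auto
    finally show False using card n by simp
  qed
qed

text \<open>In a basis \<open>b\<close> taken from \<open>M\<close>, each \<open>m\<close> is the
  pairing of a rational vector \<open>q m\<close> with \<open>b\<close>. Take rational vectors near
  \<open>b\<close> whose cone contains \<open>b\<close> in its interior, namely \<rho> + \<epsilon>
  e_k with \<rho> a rational approximation of \<open>b\<close>. The coordinates of \<open>b\<close>
  in them form the new basis, and the pairings of \<open>q m\<close> with them are the new
  coordinates of \<open>m\<close>, positive because pairing with \<open>b\<close> itself gives
  \<open>m > 0\<close>. Clearing denominators makes these coordinates integers.\<close>

lemma exists_rat_basis_positive_coords:
  fixes M :: "real set"
  assumes fin: "finite M" and pos: "\<And>m. m \<in> M \<Longrightarrow> m > 0" and n: "n = rat_real.dim M"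
  obtains l :: "nat \<Rightarrow> real" and a :: "real \<Rightarrow> nat \<Rightarrow> nat" where
    "\<And>i. i < n \<Longrightarrow> l i > 0" "inj_on l {..<n}" "rat_real.independent (l ` {..<n})"
    "\<And>m i. m \<in> M \<Longrightarrow> i < n \<Longrightarrow> a m i > 0"
    "\<And>m. m \<in> M \<Longrightarrow> m = (\<Sum>i<n. real (a m i) * l i)"
proof -
  obtain B where B: "B \<subseteq> M" "M \<subseteq> rat_real.span B" "card B = n"
    using rat_real.basis_exists[of M] n by metis
  have "finite B" using B fin finite_subset by blast
  then obtain b where b: "bij_betw b {..<n} B"
    using ex_bij_betw_nat_finite B(3) by (metis lessThan_atLeast0)
  have b_pos: "b k > 0" if "k < n" for k
    using b that B(1) pos by (auto simp: bij_betw_def)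
  have "\<exists>q. m = (\<Sum>k<n. of_rat (q k) * b k)" if "m \<in> M" for m
  proof -
    have "m \<in> rat_real.span B" using that B by auto
    then obtain u where "m = (\<Sum>v\<in>B. of_rat (u v) * v)"
      unfolding rat_real.span_finite[OF \<open>finite B\<close>] by auto
    also have "\<dots> = (\<Sum>k<n. of_rat (u (b k)) * b k)"
      by (rule sum.reindex_bij_betw[OF b, symmetric])
    finally show ?thesis by (intro exI[of _ "\<lambda>k. u (b k)"])
  qed
  then have "\<exists>q. \<forall>m\<in>M. m = (\<Sum>k<n. of_rat (q m k) * b k)"
    by (intro bchoice ballI)
  then obtain q where q: "\<And>m. m \<in> M \<Longrightarrow> m = (\<Sum>k<n. of_rat (q m k) * b k)"
    by blast
  define s where "s = (\<Sum>k<n. b k)"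

  \<comment> \<open>\<epsilon> is fixed first, small enough that the limits of the coordinates
    \<open>w m k\<close> for \<rho> tending to \<open>b\<close> are positive.\<close>
  have "\<forall>\<^sub>F N in sequentially. \<forall>p\<in>M \<times> {..<n}.
          fst p + inverse (real (Suc N)) * of_rat (q (fst p) (snd p)) > 0"
  proof (intro eventually_ball_finite ballI)
    fix p assume p: "p \<in> M \<times> {..<n}"
    have "(\<lambda>N. fst p + inverse (real (Suc N)) * of_rat (q (fst p) (snd p)))
            \<longlonglongrightarrow> fst p + 0 * of_rat (q (fst p) (snd p))"
      by (intro tendsto_intros LIMSEQ_inverse_real_of_nat)
    then show "\<forall>\<^sub>F N in sequentially. fst p + inverse (real (Suc N)) * of_rat (q (fst p) (snd p)) > 0"
      by (rule order_tendstoD(1)) (use p pos in auto)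
  qed (use fin in auto)
  then obtain N where N: "\<And>m k. m \<in> M \<Longrightarrow> k < n \<Longrightarrow>
      m + inverse (real (Suc N)) * of_rat (q m k) > 0"
    using eventually_happens'[OF sequentially_bot] by fastforce
  define \<epsilon> :: rat where "\<epsilon> = inverse (of_nat (Suc N))"
  have \<epsilon>: "\<epsilon> > 0" "\<And>m k. m \<in> M \<Longrightarrow> k < n \<Longrightarrow> m + of_rat \<epsilon> * of_rat (q m k) > 0"
    using N by (auto simp: \<epsilon>_def of_rat_inverse of_rat_add)

  have "\<forall>N k. \<exists>r::rat. b k < of_rat r \<and> of_rat r < b k + inverse (real (Suc N))"
    by (intro allI of_rat_dense) simp
  then obtain \<rho> :: "nat \<Rightarrow> nat \<Rightarrow> rat" where
    \<rho>: "\<And>N k. b k < of_rat (\<rho> N k)" "\<And>N k. of_rat (\<rho> N k) < b k + inverse (real (Suc N))"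
    unfolding choice_iff by blast
  have \<rho>_lim: "(\<lambda>N. real_of_rat (\<rho> N k)) \<longlonglongrightarrow> b k" for k
  proof (rule real_tendsto_sandwich[where f = "\<lambda>_. b k" and h = "\<lambda>N. b k + inverse (real (Suc N))"])
    show "(\<lambda>N. b k + inverse (real (Suc N))) \<longlonglongrightarrow> b k"
      using tendsto_add[OF tendsto_const LIMSEQ_inverse_real_of_nat, of "b k"] by simp
    show "\<forall>\<^sub>F N in sequentially. real_of_rat (\<rho> N k) \<le> b k + inverse (real (Suc N))"
      by (intro always_eventually allI less_imp_le \<rho>(2))
    show "\<forall>\<^sub>F N in sequentially. b k \<le> real_of_rat (\<rho> N k)"
      by (intro always_eventually allI less_imp_le \<rho>(1))
  qed (rule tendsto_const)
  \<comment> \<open>Divided by the positive number \<open>(e + P) * e\<close>, this expression will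
    be \<open>l0 k\<close>. Its limit for \<rho> tending to \<open>b\<close> is
    \<open>b k * \<epsilon>\<close>.\<close>
  have "\<forall>\<^sub>F N in sequentially. \<forall>k\<in>{..<n}.
          b k * (of_rat \<epsilon> + (\<Sum>j<n. of_rat (\<rho> N j))) - of_rat (\<rho> N k) * s > 0"
  proof (intro eventually_ball_finite ballI)
    fix k assume "k \<in> {..<n}"
    have "(\<lambda>N. b k * (of_rat \<epsilon> + (\<Sum>j<n. of_rat (\<rho> N j))) - of_rat (\<rho> N k) * s)
       \<longlonglongrightarrow> b k * (of_rat \<epsilon> + (\<Sum>j<n. b j)) - b k * s"
      by (intro tendsto_intros \<rho>_lim)
    then show "\<forall>\<^sub>F N in sequentially.
          b k * (of_rat \<epsilon> + (\<Sum>j<n. of_rat (\<rho> N j))) - of_rat (\<rho> N k) * s > 0"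
      by (rule order_tendstoD(1))
         (use b_pos[of k] \<epsilon>(1) \<open>k \<in> {..<n}\<close> in \<open>auto simp: s_def algebra_simps\<close>)
  qed auto
  moreover have "\<forall>\<^sub>F N in sequentially. \<forall>p\<in>M \<times> {..<n}.
      (\<Sum>j<n. of_rat (q (fst p) j) * of_rat (\<rho> N j)) + of_rat \<epsilon> * of_rat (q (fst p) (snd p)) > (0::real)"
  proof (intro eventually_ball_finite ballI)
    fix p assume p: "p \<in> M \<times> {..<n}"
    have "(\<lambda>N. (\<Sum>j<n. real_of_rat (q (fst p) j) * of_rat (\<rho> N j)) + of_rat \<epsilon> * of_rat (q (fst p) (snd p)))
       \<longlonglongrightarrow> (\<Sum>j<n. of_rat (q (fst p) j) * b j) + of_rat \<epsilon> * of_rat (q (fst p) (snd p))"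
      by (intro tendsto_intros \<rho>_lim)
    then show "\<forall>\<^sub>F N in sequentially.
        (\<Sum>j<n. of_rat (q (fst p) j) * of_rat (\<rho> N j)) + of_rat \<epsilon> * of_rat (q (fst p) (snd p)) > (0::real)"
      by (rule order_tendstoD(1)) (use p \<epsilon>(2) q in auto)
  qed (use fin in auto)
  ultimately obtain N where
    N1: "\<And>k. k < n \<Longrightarrow> b k * (of_rat \<epsilon> + (\<Sum>j<n. of_rat (\<rho> N j))) - of_rat (\<rho> N k) * s > 0"
    and N2: "\<And>m k. m \<in> M \<Longrightarrow> k < n \<Longrightarrow>
        (\<Sum>j<n. real_of_rat (q m j) * of_rat (\<rho> N j)) + of_rat \<epsilon> * of_rat (q m k) > 0"
    using eventually_happens'[OF sequentially_bot eventually_conj] by fastforce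
  define P :: real where "P = (\<Sum>j<n. of_rat (\<rho> N j))"
  define w where "w = (\<lambda>m k. (\<Sum>j<n. q m j * \<rho> N j) + \<epsilon> * q m k)"
  have w_eq: "real_of_rat (w m k) = (\<Sum>j<n. of_rat (q m j) * of_rat (\<rho> N j)) + of_rat \<epsilon> * of_rat (q m k)"
    for m k by (simp add: w_def of_rat_add of_rat_mult of_rat_sum)
  have w_pos: "w m k > 0" if "m \<in> M" "k < n" for m k
    using N2[OF that] unfolding w_eq[symmetric] by simp
  have "P \<ge> 0" unfolding P_def
    using b_pos \<rho>(1)[where N = N] by (intro sum_nonneg) (smt (verit) lessThan_iff)
  define e :: real where "e = of_rat \<epsilon>"
  have "e > 0" using \<epsilon> by (simp add: e_def)
  \<comment> \<open>\<open>L\<close> must be the sum of the \<open>l0 k\<close>: summing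
    \<open>b k = L * \<rho> N k + e * l0 k\<close> over \<open>k\<close> then gives
    \<open>s = L * (P + e)\<close>.\<close>
  define L where "L = s / (e + P)"
  \<comment> \<open>The coordinates of \<open>b\<close> with respect to the vectors \<open>\<rho> + \<epsilon> e\<^sub>k\<close>.\<close>
  define l0 where "l0 = (\<lambda>k. (b k - L * of_rat (\<rho> N k)) / e)"
  have l0_pos: "l0 k > 0" if "k < n" for k
  proof -
    have "e + P > 0" using \<open>e > 0\<close> \<open>P \<ge> 0\<close> by simp
    then have "l0 k = (b k * (e + P) - of_rat (\<rho> N k) * s) / ((e + P) * e)"
      using \<open>e > 0\<close> by (simp add: l0_def L_def field_simps)
    moreover have "b k * (e + P) - of_rat (\<rho> N k) * s > 0"
      using N1[OF that] by (simp add: P_def e_def)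
    ultimately show ?thesis
      using \<open>e > 0\<close> \<open>e + P > 0\<close> by simp
  qed
  have b_eq: "b k = L * of_rat (\<rho> N k) + e * l0 k" for k
    using \<open>e > 0\<close> by (simp add: l0_def)
  have "(\<Sum>k<n. l0 k) = (s - L * P) / e"
    by (simp add: l0_def s_def P_def sum_divide_distrib[symmetric] sum_subtractf sum_distrib_left)
  also have "s = L * (e + P)" using \<open>e > 0\<close> \<open>P \<ge> 0\<close> by (simp add: L_def)
  finally have L_eq: "(\<Sum>k<n. l0 k) = L" using \<open>e > 0\<close> by (simp add: algebra_simps)
  have m_eq: "m = (\<Sum>k<n. of_rat (w m k) * l0 k)" if "m \<in> M" for m
  proof -
    define Q :: real where "Q = (\<Sum>j<n. of_rat (q m j) * of_rat (\<rho> N j))"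
    have "(\<Sum>k<n. of_rat (w m k) * l0 k) = Q * (\<Sum>k<n. l0 k) + (\<Sum>k<n. e * of_rat (q m k) * l0 k)"
      unfolding w_eq e_def[symmetric] Q_def[symmetric]
      by (simp add: sum_distrib_left sum.distrib algebra_simps)
    also have "\<dots> = (\<Sum>k<n. of_rat (q m k) * b k)"
      unfolding L_eq b_eq Q_def by (simp add: sum_distrib_left sum.distrib algebra_simps)
    finally show ?thesis using q[OF that] by simp
  qed

  obtain D :: nat where D: "D > 0"
    "\<And>m k. m \<in> M \<Longrightarrow> k < n \<Longrightarrow> \<exists>z::int. w m k * of_nat D = of_int z"
    using rat_common_denominator[of "M \<times> {..<n}" "\<lambda>(m, k). w m k"] fin by force
  define l where "l = (\<lambda>k. l0 k / real D)"
  define a where "a = (\<lambda>m k. nat \<lfloor>w m k * of_nat D\<rfloor>)"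
  have a: "of_nat (a m k) = w m k * of_nat D" "a m k > 0" if mk: "m \<in> M" "k < n" for m k
  proof -
    obtain z :: int where z: "w m k * of_nat D = of_int z" using D(2)[OF mk] by blast
    have "w m k * of_nat D > 0" using w_pos[OF mk] D(1) by simp
    then have "z > 0" unfolding z by simp
    then show "of_nat (a m k) = w m k * of_nat D" "a m k > 0"
      unfolding a_def z by (auto simp: of_nat_nat)
  qed
  have ml: "m = (\<Sum>i<n. real (a m i) * l i)" if "m \<in> M" for m
  proof -
    have "real (a m i) * l i = of_rat (w m i) * l0 i" if "i < n" for i
    proof -
      have "real (a m i) = of_rat (of_nat (a m i))" by simp
      also have "\<dots> = of_rat (w m i) * real D"
        unfolding a(1)[OF \<open>m \<in> M\<close> that] by (simp add: of_rat_mult)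
      finally show ?thesis using D(1) by (simp add: l_def)
    qed
    then show ?thesis using m_eq[OF that] by simp
  qed
  have "M \<subseteq> rat_real.span (l ` {..<n})"
  proof
    fix m assume "m \<in> M"
    have "(\<Sum>i<n. of_rat (of_nat (a m i)) * l i) \<in> rat_real.span (l ` {..<n})"
      by (intro rat_real.span_sum rat_real.span_scale rat_real.span_base) auto
    with ml[OF \<open>m \<in> M\<close>] show "m \<in> rat_real.span (l ` {..<n})" by simp
  qed
  note indep = rat_independent_if_spanning[OF this n]
  show thesis
    by (rule that[OF _ indep a(2) ml]) (use l0_pos D(1) in \<open>auto simp: l_def\<close>)
qed

section \<open>Zero-free polydiscs\<close>

lemma rat_independent_coeffs:
  fixes l :: "nat \<Rightarrow> real"
  assumes "inj_on l {..<n}" "rat_real.independent (l ` {..<n})"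
    and sum: "(\<Sum>i<n. of_rat (q i) * l i) = 0" and "i < n"
  shows "q i = 0"
proof -
  define u where "u = (\<lambda>x. q (the_inv_into {..<n} l x))"
  have u: "u (l k) = q k" if "k < n" for k
    using assms(1) that by (simp add: u_def the_inv_into_f_f)
  have "(\<Sum>x\<in>l ` {..<n}. of_rat (u x) * x) = (\<Sum>i<n. of_rat (q i) * l i)"
    unfolding sum.reindex[OF assms(1)] by (intro sum.cong) (auto simp: u)
  then have "u (l i) = 0"
    using rat_real.independentD[OF assms(2), of "l ` {..<n}" u "l i"] sum \<open>i < n\<close> by simp
  with u \<open>i < n\<close> show ?thesis by simp
qed

text \<open>This supplies the integral independence in Kronecker's theorem; the scale
  \<open>r\<close> will be \<open>2 * pi\<close>.\<close>

lemma int_independent_if_rat_independent: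
  fixes l :: "nat \<Rightarrow> real"
  assumes l: "inj_on l {..<n}" "rat_real.independent (l ` {..<n})" and "r \<noteq> 0"
  shows "module.independent (\<lambda>k. (*) (real_of_int k)) ((\<lambda>i. l i / r) ` {..<n})"
proof -
  interpret int_real: Modules.module "\<lambda>k. (*) (real_of_int k)"
    by unfold_locales (simp_all add: algebra_simps)
  have inj: "inj_on (\<lambda>i. l i / r) {..<n}"
    using l(1) \<open>r \<noteq> 0\<close> by (auto simp: inj_on_def)
  show ?thesis
  proof
    assume "int_real.dependent ((\<lambda>i. l i / r) ` {..<n})"
    then obtain u v where uv: "v \<in> (\<lambda>i. l i / r) ` {..<n}" "u v \<noteq> 0"
      "(\<Sum>x\<in>(\<lambda>i. l i / r) ` {..<n}. real_of_int (u x) * x) = 0"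
      by (subst (asm) int_real.dependent_finite) auto
    then obtain i where i: "i < n" "v = l i / r" by auto
    have "(\<Sum>i<n. of_rat (of_int (u (l i / r))) * l i)
        = r * (\<Sum>x\<in>(\<lambda>i. l i / r) ` {..<n}. real_of_int (u x) * x)"
      unfolding sum.reindex[OF inj] using \<open>r \<noteq> 0\<close> by (simp add: sum_distrib_left)
    then have "(of_int (u (l i / r)) :: rat) = 0"
      using rat_independent_coeffs[OF l _ i(1), of "\<lambda>i. of_int (u (l i / r))"] uv(3) by simp
    with uv i show False by simp
  qed
qed

text \<open>Kronecker's theorem for the numbers \<open>l i / (2 * pi)\<close> with targets
  \<open>Arg (\<omega> i) / (2 * pi)\<close> and tolerance \<open>1 / Suc k\<close>.\<close>

lemma Kronecker_torus_sequence:
  fixes l :: "nat \<Rightarrow> real" and \<omega> :: "nat \<Rightarrow> complex"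
  assumes l: "inj_on l {..<n}" "rat_real.independent (l ` {..<n})"
    and \<omega>: "\<And>i. i < n \<Longrightarrow> cmod (\<omega> i) = 1"
  obtains t :: "nat \<Rightarrow> real" where "\<And>i. i < n \<Longrightarrow> (\<lambda>k. cis (l i * t k)) \<longlonglongrightarrow> \<omega> i"
proof -
  have inj: "inj_on (\<lambda>i. l i / (2 * pi)) {..<n}"
    using l(1) by (auto simp: inj_on_def)
  have "\<exists>t h. \<forall>i<n. \<bar>t * (l i / (2 * pi)) - of_int (h i) - Arg (\<omega> i) / (2 * pi)\<bar> < 1 / real (Suc k)" for k
    by (rule Kronecker_thm_1[OF int_independent_if_rat_independent[OF l, of "2 * pi"] inj,
          of "1 / real (Suc k)" "\<lambda>i. Arg (\<omega> i) / (2 * pi)"]) auto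
  then obtain t h where th: "\<And>k i. i < n \<Longrightarrow>
      \<bar>t k * (l i / (2 * pi)) - of_int (h k i) - Arg (\<omega> i) / (2 * pi)\<bar> < 1 / real (Suc k)"
    by metis
  show thesis
  proof
    fix i assume i: "i < n"
    define y where "y = (\<lambda>k. t k * (l i / (2 * pi)) - of_int (h k i) - Arg (\<omega> i) / (2 * pi))"
    have "y \<longlonglongrightarrow> 0"
    proof (rule Lim_null_comparison)
      show "\<forall>\<^sub>F k in sequentially. norm (y k) \<le> inverse (real (Suc k))"
        using th[OF i] by (auto simp: y_def inverse_eq_divide intro!: always_eventually less_imp_le)
    qed (rule LIMSEQ_inverse_real_of_nat)
    then have "(\<lambda>k. cis (2 * pi * y k) * \<omega> i) \<longlonglongrightarrow> cis (2 * pi * 0) * \<omega> i"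
      by (intro tendsto_intros)
    moreover have "cis (2 * pi * y k) * \<omega> i = cis (l i * t k)" for k
    proof -
      have "2 * pi * y k = l i * t k - 2 * pi * of_int (h k i) - Arg (\<omega> i)"
        by (simp add: y_def field_simps)
      moreover have "\<omega> i = cis (Arg (\<omega> i))"
        using \<omega>[OF i] by (metis cis_Arg norm_zero sgn_eq scaleR_one inverse_1 sgn_div_norm zero_neq_one)
      ultimately show ?thesis
        by (metis cis_divide cis_multiple_2pi cis_neq_zero div_by_1 nonzero_eq_divide_eq Ints_of_int)
    qed
    ultimately show "(\<lambda>k. cis (l i * t k)) \<longlonglongrightarrow> \<omega> i" by simp
  qed
qed

text \<open>High up, the constant term \<open>c j0\<close> dominates. \<open>Y\<close> is chosen
  with \<open>C * exp (- \<beta> * Y) < cmod (c j0)\<close>, the summand 1 giving strictness. It is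
  uniform in the coefficients and frequencies, so zeros cannot escape upwards when either is
  varied.\<close>

lemma exp_sum_nonzero_far_up:
  fixes c :: "'a \<Rightarrow> complex"
  assumes J: "finite J" "j0 \<in> J" and c: "c j0 \<noteq> 0" and "\<beta> > 0"
  obtains Y :: real where "Y > 0"
    "\<And>d b x. (\<And>j. j \<in> J \<Longrightarrow> cmod (d j) \<le> cmod (c j)) \<Longrightarrow> d j0 = c j0 \<Longrightarrow> b j0 = 0 \<Longrightarrow>
       (\<And>j. j \<in> J - {j0} \<Longrightarrow> b j \<ge> \<beta>) \<Longrightarrow> Im x \<ge> Y \<Longrightarrow>
       (\<Sum>j\<in>J. d j * exp (\<i> * of_real (b j) * x)) \<noteq> 0"
proof -
  define C where "C = (\<Sum>j\<in>J. cmod (c j))"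
  have C: "C \<ge> cmod (c j0)" unfolding C_def using J by (intro member_le_sum) auto
  then have "C > 0" using c by (smt (verit) zero_less_norm_iff)
  define Y where "Y = ln (C / cmod (c j0)) / \<beta> + 1"
  have "Y > 0" using C c \<open>\<beta> > 0\<close> by (auto simp: Y_def intro!: add_nonneg_pos divide_nonneg_pos ln_ge_zero)
  have "- \<beta> * Y = - ln (C / cmod (c j0)) + - \<beta>"
    using \<open>\<beta> > 0\<close> by (simp add: Y_def algebra_simps)
  then have "C * exp (- \<beta> * Y) = cmod (c j0) * exp (- \<beta>)"
    using \<open>C > 0\<close> c by (simp only: exp_add exp_minus[of "ln _"]) simp
  also have "\<dots> < cmod (c j0)" using c \<open>\<beta> > 0\<close> by simp
  finally have CY: "C * exp (- \<beta> * Y) < cmod (c j0)" .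
  show thesis
  proof (rule that[OF \<open>Y > 0\<close>])
    fix d and b :: "'a \<Rightarrow> real" and x
    assume d: "\<And>j. j \<in> J \<Longrightarrow> cmod (d j) \<le> cmod (c j)" "d j0 = c j0"
      and b: "b j0 = 0" "\<And>j. j \<in> J - {j0} \<Longrightarrow> b j \<ge> \<beta>" and x: "Im x \<ge> Y"
    have "cmod (\<Sum>j\<in>J - {j0}. d j * exp (\<i> * of_real (b j) * x))
        \<le> (\<Sum>j\<in>J - {j0}. cmod (c j) * exp (- \<beta> * Y))"
    proof (intro sum_norm_le)
      fix j assume j: "j \<in> J - {j0}"
      have "\<beta> * Y \<le> b j * Im x"
        using b(2)[OF j] x \<open>\<beta> > 0\<close> \<open>Y > 0\<close> by (intro mult_mono) auto
      then show "cmod (d j * exp (\<i> * of_real (b j) * x)) \<le> cmod (c j) * exp (- \<beta> * Y)"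
        using j d(1) by (auto simp: norm_mult intro!: mult_mono)
    qed
    also have "\<dots> \<le> C * exp (- \<beta> * Y)"
      unfolding C_def sum_distrib_right using J by (intro sum_mono2) auto
    also note CY
    finally have lt: "cmod (\<Sum>j\<in>J - {j0}. d j * exp (\<i> * of_real (b j) * x)) < cmod (c j0)" .
    have "(\<Sum>j\<in>J. d j * exp (\<i> * of_real (b j) * x))
        = c j0 + (\<Sum>j\<in>J - {j0}. d j * exp (\<i> * of_real (b j) * x))"
      using J b(1) d(2) by (simp add: sum.remove)
    with lt show "(\<Sum>j\<in>J. d j * exp (\<i> * of_real (b j) * x)) \<noteq> 0"
      by (metis add_eq_0_iff norm_minus_cancel order_less_irrefl)
  qed
qed

section \<open>Polynomials along exponential curves\<close>

lemma prod_exp_power: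
  fixes n :: nat and v :: "nat \<Rightarrow> real"
  shows "(\<Prod>i<n. (exp (\<i> * of_real (v i) * x)) ^ e i) = exp (\<i> * of_real (\<Sum>i<n. real (e i) * v i) * x)"
proof -
  have "(\<Prod>i<n. (exp (\<i> * of_real (v i) * x)) ^ e i)
      = exp (\<Sum>i<n. of_nat (e i) * (\<i> * of_real (v i) * x))"
    by (simp add: exp_sum exp_of_nat_mult)
  also have "(\<Sum>i<n. of_nat (e i) * (\<i> * of_real (v i) * x)) = \<i> * of_real (\<Sum>i<n. real (e i) * v i) * x"
    by (simp add: sum_distrib_left sum_distrib_right mult_ac)
  finally show ?thesis .
qed

text \<open>This setting serves twice: for the polynomial with \<open>j0 = 0\<close> and for its
  reversal with \<open>j0 = K\<close>. Every monomial other than the constant one contains every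
  variable, so the constant term dominates far out in each positive direction.\<close>

locale stable_exp_sum =
  fixes J :: "'a set" and j0 :: 'a and c :: "'a \<Rightarrow> complex"
    and a :: "'a \<Rightarrow> nat \<Rightarrow> nat" and n :: nat and l :: "nat \<Rightarrow> real"
  assumes J: "finite J" "j0 \<in> J" and c: "c j0 \<noteq> 0" and n_pos: "n > 0"
    and a_j0: "\<And>i. i < n \<Longrightarrow> a j0 i = 0"
    and a_pos: "\<And>j i. j \<in> J - {j0} \<Longrightarrow> i < n \<Longrightarrow> a j i > 0"
    and l_pos: "\<And>i. i < n \<Longrightarrow> l i > 0"
    and l_indep: "inj_on l {..<n}" "rat_real.independent (l ` {..<n})"
    and nonzero_on_line: "\<And>x. Im x > 0 \<Longrightarrow>
      (\<Sum>j\<in>J. c j * exp (\<i> * of_real (\<Sum>i<n. real (a j i) * l i) * x)) \<noteq> 0"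
begin

definition P :: "(nat \<Rightarrow> complex) \<Rightarrow> complex" where
  "P z = (\<Sum>j\<in>J. c j * (\<Prod>i<n. z i ^ a j i))"

lemma P_cong: "(\<And>i. i < n \<Longrightarrow> z i = z' i) \<Longrightarrow> P z = P z'"
  by (simp add: P_def)

text \<open>Along the curve with base point \<open>w\<close> and direction \<open>v\<close>,
  \<open>P\<close> becomes an exponential sum in the single variable \<open>x\<close>. This makes
  Hurwitz' theorem available when base points or directions vary.\<close>

lemma P_exp:
  "P (\<lambda>i. w i * exp (\<i> * of_real (v i) * x))
     = (\<Sum>j\<in>J. (c j * (\<Prod>i<n. w i ^ a j i)) * exp (\<i> * of_real (\<Sum>i<n. real (a j i) * v i) * x))"
  unfolding P_def power_mult_distrib prod.distrib prod_exp_power by (simp add: mult.assoc)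

lemma sum_le_weighted:
  assumes "j \<in> J - {j0}" "\<And>i. i < n \<Longrightarrow> v i \<ge> 0"
  shows "(\<Sum>i<n. v i) \<le> (\<Sum>i<n. real (a j i) * v i)"
proof (intro sum_mono)
  fix i assume "i \<in> {..<n}"
  then have "1 * v i \<le> real (a j i) * v i"
    using a_pos[OF assms(1), of i] assms(2)[of i] by (intro mult_right_mono) auto
  then show "v i \<le> real (a j i) * v i" by simp
qed

lemma P_nonzero_far_up:
  assumes "\<beta> > 0"
  obtains Y :: real where "Y > 0"
    "\<And>w v x. (\<And>i. i < n \<Longrightarrow> cmod (w i) \<le> 1) \<Longrightarrow> (\<And>i. i < n \<Longrightarrow> v i \<ge> 0) \<Longrightarrow>
       (\<Sum>i<n. v i) \<ge> \<beta> \<Longrightarrow> Im x \<ge> Y \<Longrightarrow> P (\<lambda>i. w i * exp (\<i> * of_real (v i) * x)) \<noteq> 0"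
proof -
  obtain Y :: real where Y: "Y > 0"
    "\<And>d b x. (\<And>j. j \<in> J \<Longrightarrow> cmod (d j) \<le> cmod (c j)) \<Longrightarrow> d j0 = c j0 \<Longrightarrow> b j0 = 0 \<Longrightarrow>
       (\<And>j. j \<in> J - {j0} \<Longrightarrow> b j \<ge> \<beta>) \<Longrightarrow> Im x \<ge> Y \<Longrightarrow>
       (\<Sum>j\<in>J. d j * exp (\<i> * of_real (b j) * x)) \<noteq> 0"
    by (rule exp_sum_nonzero_far_up[of J j0 c \<beta>, OF J c assms]) blast
  show thesis
  proof (rule that[OF Y(1)])
    fix w :: "nat \<Rightarrow> complex" and v :: "nat \<Rightarrow> real" and x
    assume w: "\<And>i. i < n \<Longrightarrow> cmod (w i) \<le> 1" and v: "\<And>i. i < n \<Longrightarrow> v i \<ge> 0"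
      and \<beta>: "(\<Sum>i<n. v i) \<ge> \<beta>" and x: "Im x \<ge> Y"
    show "P (\<lambda>i. w i * exp (\<i> * of_real (v i) * x)) \<noteq> 0"
      unfolding P_exp
    proof (rule Y(2))
      show "cmod (c j * (\<Prod>i<n. w i ^ a j i)) \<le> cmod (c j)" for j
        using w by (auto simp: norm_mult prod_norm[symmetric] norm_power
            intro!: mult_left_le prod_le_1 power_le_one)
      show "(\<Sum>i<n. real (a j i) * v i) \<ge> \<beta>" if "j \<in> J - {j0}" for j
        using sum_le_weighted[of j v, OF that v] \<beta> by simp
    qed (use a_j0 x in auto)
  qed
qed

text \<open>A real shift of \<open>x\<close> by \<open>t\<close> multiplies coordinate
  \<open>i\<close> by \<open>cis (l i * t)\<close>, and by Kronecker such phases approximate any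
  \<omega>. Nonvanishing passes to the limit by Hurwitz, the point \<open>\<i> * Y\<close> high up
  excluding the zero limit.\<close>

lemma P_nonzero_on_l_torus:
  assumes \<omega>: "\<And>i. i < n \<Longrightarrow> cmod (\<omega> i) = 1" and x: "Im x > 0"
  shows "P (\<lambda>i. \<omega> i * exp (\<i> * of_real (l i) * x)) \<noteq> 0"
proof -
  have "(\<Sum>i<n. l i) > 0" using l_pos n_pos by (intro sum_pos) auto
  then obtain Y :: real where Y: "Y > 0"
    "\<And>w v x. (\<And>i. i < n \<Longrightarrow> cmod (w i) \<le> 1) \<Longrightarrow> (\<And>i. i < n \<Longrightarrow> v i \<ge> 0) \<Longrightarrow>
       (\<Sum>i<n. v i) \<ge> (\<Sum>i<n. l i) \<Longrightarrow> Im x \<ge> Y \<Longrightarrow>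
       P (\<lambda>i. w i * exp (\<i> * of_real (v i) * x)) \<noteq> 0"
    by (rule P_nonzero_far_up) blast
  obtain t :: "nat \<Rightarrow> real" where t: "\<And>i. i < n \<Longrightarrow> (\<lambda>k. cis (l i * t k)) \<longlonglongrightarrow> \<omega> i"
    using Kronecker_torus_sequence[of l n \<omega>, OF l_indep \<omega>] by blast
  show ?thesis
    unfolding P_exp
  proof (rule exp_sum_Hurwitz[where S = "{x. Im x > 0}" and y = "\<i> * of_real Y"
        and d = "\<lambda>k j. c j * (\<Prod>i<n. cis (l i * t k) ^ a j i)"
        and \<beta> = "\<lambda>_ j. \<i> * of_real (\<Sum>i<n. real (a j i) * l i)"])
    show "open {x. Im x > 0}" "connected {x. Im x > 0}" "x \<in> {x. Im x > 0}"
      using x by (auto intro!: open_halfspace_Im_gt convex_connected convex_halfspace_Im_gt)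
    show "\<i> * of_real Y \<in> {x. Im x > 0}" using Y(1) by simp
    show "(\<Sum>j\<in>J. c j * (\<Prod>i<n. \<omega> i ^ a j i) *
        exp (\<i> * of_real (\<Sum>i<n. real (a j i) * l i) * (\<i> * of_real Y))) \<noteq> 0"
      unfolding P_exp[symmetric] by (rule Y(2)) (use \<omega> l_pos in \<open>auto simp: less_imp_le\<close>)
    show "(\<lambda>k. c j * (\<Prod>i<n. cis (l i * t k) ^ a j i)) \<longlonglongrightarrow> c j * (\<Prod>i<n. \<omega> i ^ a j i)" for j
      by (intro tendsto_intros t) auto
    show "(\<Sum>j\<in>J. c j * (\<Prod>i<n. cis (l i * t k) ^ a j i) *
        exp (\<i> * of_real (\<Sum>i<n. real (a j i) * l i) * x)) \<noteq> 0" if "x \<in> {x. Im x > 0}" for k x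
    proof -
      have "cis (l i * t k) * exp (\<i> * of_real (l i) * x) = 1 * exp (\<i> * of_real (l i) * (x + of_real (t k)))" for i
        by (simp add: cis_conv_exp exp_add[symmetric] algebra_simps)
      then show ?thesis
        unfolding P_exp[symmetric] using nonzero_on_line[of "x + of_real (t k)"] that
        by (simp add: P_exp[where w = "\<lambda>_. 1", simplified])
    qed
  qed auto
qed

text \<open>
  Deform the direction \<open>l\<close> into \<open>v\<close> with base point \<open>\<epsilon> l\<close>, where \<open>P\<close> does not vanish on the whole
  torus. The directions \<open>\<tau>\<close> for which \<open>P\<close> has no zeros above the base point form a closed set by
  Hurwitz' theorem, and an open set by compactness, since zeros cannot escape to infinity.
\<close>

lemma P_nonzero_direction:
  fixes v :: "nat \<Rightarrow> real"
  assumes v: "\<And>i. i < n \<Longrightarrow> v i > 0" and "\<epsilon> > 0" and \<omega>: "\<And>i. i < n \<Longrightarrow> cmod (\<omega> i) = 1" and "y \<ge> 0"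
  shows "P (\<lambda>i. \<omega> i * of_real (exp (- (\<epsilon> * l i) - y * v i))) \<noteq> 0"
proof -
  define w where "w = (\<lambda>\<tau> i. (1 - \<tau>) * l i + \<tau> * v i)"
  define Z where "Z = (\<lambda>(\<tau>, y, \<omega>). P (\<lambda>i. \<omega> i * of_real (exp (- (\<epsilon> * l i) - y * w \<tau> i))))"
  \<comment> \<open>The torus is taken over all indices, as a compact set in the product topology;
    by \<open>P_cong\<close> the coordinates from \<open>n\<close> on may be set to 1.\<close>
  define T where "T = {\<omega> :: nat \<Rightarrow> complex. \<forall>i. \<omega> i \<in> sphere 0 1}"
  define good where "good = (\<lambda>\<tau>. \<forall>y \<omega>. y \<ge> 0 \<longrightarrow> (\<forall>i<n. cmod (\<omega> i) = 1) \<longrightarrow> Z (\<tau>, y, \<omega>) \<noteq> 0)"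
  have w_pos: "w \<tau> i > 0" if "\<tau> \<in> {0..1}" "i < n" for \<tau> i
  proof (cases "\<tau> = 0")
    case False
    then show ?thesis using that v[of i] l_pos[of i]
      unfolding w_def by (intro add_nonneg_pos mult_nonneg_nonneg mult_pos_pos) auto
  qed (use that l_pos in \<open>simp add: w_def\<close>)
  \<comment> \<open>The real part of \<open>x\<close> only rotates \<omega>. Hence nonvanishing of
    \<open>Z\<close> for all \<omega> and all \<open>y > 0\<close> gives nonvanishing of the
    exponential sums on the upper half-plane.\<close>
  have Z_exp: "Z (\<tau>, Im x, \<lambda>i. \<omega> i * exp (\<i> * of_real (w \<tau> i * Re x)))
      = P (\<lambda>i. (\<omega> i * of_real (exp (- (\<epsilon> * l i)))) * exp (\<i> * of_real (w \<tau> i) * x))" for \<tau> x \<omega>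
    unfolding Z_def prod.case
  proof (rule P_cong)
    fix i
    have "\<i> * of_real (w \<tau> i * Re x) + of_real (- (\<epsilon> * l i) - Im x * w \<tau> i)
        = of_real (- (\<epsilon> * l i)) + \<i> * of_real (w \<tau> i) * x"
      by (simp add: complex_eq_iff)
    then have "exp (\<i> * of_real (w \<tau> i * Re x)) * of_real (exp (- (\<epsilon> * l i) - Im x * w \<tau> i))
        = of_real (exp (- (\<epsilon> * l i))) * exp (\<i> * of_real (w \<tau> i) * x)"
      by (simp only: exp_of_real[symmetric] exp_add[symmetric])
    then show "\<omega> i * exp (\<i> * of_real (w \<tau> i * Re x)) * of_real (exp (- (\<epsilon> * l i) - Im x * w \<tau> i))
        = \<omega> i * of_real (exp (- (\<epsilon> * l i))) * exp (\<i> * of_real (w \<tau> i) * x)"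
      by (simp add: mult.assoc)
  qed
  have Z_iy: "Z (\<tau>, y, \<omega>)
      = P (\<lambda>i. (\<omega> i * of_real (exp (- (\<epsilon> * l i)))) * exp (\<i> * of_real (w \<tau> i) * (\<i> * of_real y)))" for \<tau> y \<omega>
    using Z_exp[of \<tau> "\<i> * of_real y" \<omega>] by simp

  \<comment> \<open>A lower bound for the total weight of all interpolated directions, so that one
    height \<open>Y\<close> works for every \<tau>.\<close>
  define \<beta> where "\<beta> = min (\<Sum>i<n. l i) (\<Sum>i<n. v i)"
  have "\<beta> > 0" using l_pos v n_pos by (auto simp: \<beta>_def intro!: sum_pos)
  have w_ge: "(\<Sum>i<n. w \<tau> i) \<ge> \<beta>" if "\<tau> \<in> {0..1}" for \<tau>
  proof -
    have "\<beta> = (1 - \<tau>) * \<beta> + \<tau> * \<beta>" by (simp add: algebra_simps)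
    also have "\<dots> \<le> (1 - \<tau>) * (\<Sum>i<n. l i) + \<tau> * (\<Sum>i<n. v i)"
      using that by (intro add_mono mult_left_mono) (auto simp: \<beta>_def)
    also have "\<dots> = (\<Sum>i<n. w \<tau> i)" by (simp add: w_def sum.distrib sum_distrib_left)
    finally show ?thesis .
  qed
  obtain Y where Y: "Y > 0"
    "\<And>w v x. (\<And>i. i < n \<Longrightarrow> cmod (w i) \<le> 1) \<Longrightarrow> (\<And>i. i < n \<Longrightarrow> v i \<ge> 0) \<Longrightarrow>
       (\<Sum>i<n. v i) \<ge> \<beta> \<Longrightarrow> Im x \<ge> Y \<Longrightarrow> P (\<lambda>i. w i * exp (\<i> * of_real (v i) * x)) \<noteq> 0"
    by (rule P_nonzero_far_up[OF \<open>\<beta> > 0\<close>]) blast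
  have base_le: "cmod (\<omega> i * of_real (exp (- (\<epsilon> * l i)))) \<le> 1" if "i < n" "cmod (\<omega> i) = 1" for i \<omega>
    using that l_pos[of i] \<open>\<epsilon> > 0\<close> by (simp add: norm_mult)
  have far: "Z (\<tau>, y, \<omega>) \<noteq> 0"
    if "\<tau> \<in> {0..1}" "y \<ge> Y" "\<And>i. i < n \<Longrightarrow> cmod (\<omega> i) = 1" for \<tau> y \<omega>
    unfolding Z_iy
    by (rule Y(2)) (use that base_le w_pos w_ge in \<open>auto simp: less_imp_le\<close>)

  have "continuous_on UNIV Z"
    unfolding Z_def P_def w_def case_prod_unfold
    by (intro continuous_intros continuous_on_compose2[OF continuous_on_product_coordinates]) auto
  then have "closed {p. Z p = 0}"
    by (intro closed_Collect_eq continuous_intros) auto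
  moreover have "compact T"
  proof -
    have "compactin (product_topology (\<lambda>_. euclidean) UNIV) (PiE UNIV (\<lambda>_::nat. sphere (0::complex) 1))"
      unfolding compactin_PiE by auto
    moreover have "PiE UNIV (\<lambda>_::nat. sphere (0::complex) 1) = T"
      by (auto simp: T_def PiE_def Pi_def)
    ultimately show ?thesis by (simp add: euclidean_product_topology)
  qed
  \<comment> \<open>By \<open>far\<close>, zeros occur only at heights below \<open>Y\<close>; the
    bad parameters are therefore a projection of a compact set.\<close>
  ultimately have "compact (({0..1} \<times> {0..Y} \<times> T) \<inter> {p. Z p = 0})"
    by (intro compact_Int_closed compact_Times) auto
  then have closed_bad: "closed (fst ` (({0..1} \<times> {0..Y} \<times> T) \<inter> {p. Z p = 0}))" (is "closed ?Bad")
    by (intro compact_imp_closed compact_continuous_image continuous_intros)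
  have bad_iff: "\<tau> \<in> ?Bad \<longleftrightarrow> \<not> good \<tau>" if "\<tau> \<in> {0..1}" for \<tau>
  proof
    assume "\<tau> \<in> ?Bad"
    then obtain y \<omega> where "y \<ge> 0" "\<omega> \<in> T" "Z (\<tau>, y, \<omega>) = 0" by auto
    then show "\<not> good \<tau>" by (auto simp: good_def T_def)
  next
    assume "\<not> good \<tau>"
    then obtain y \<omega> where y: "y \<ge> 0" "\<And>i. i < n \<Longrightarrow> cmod (\<omega> i) = 1" "Z (\<tau>, y, \<omega>) = 0"
      by (auto simp: good_def)
    define \<omega>' where "\<omega>' = (\<lambda>i. if i < n then \<omega> i else 1)"
    have "Z (\<tau>, y, \<omega>') = 0"
      using y(3) unfolding Z_def prod.case by (subst P_cong) (auto simp: \<omega>'_def)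
    moreover have "\<omega>' \<in> T" using y(2) by (auto simp: T_def \<omega>'_def)
    moreover have "y \<le> Y"
    proof (rule ccontr)
      assume "\<not> y \<le> Y"
      then have "Z (\<tau>, y, \<omega>) \<noteq> 0" by (intro far that y(2)) simp
      with y(3) show False by simp
    qed
    ultimately have "(\<tau>, y, \<omega>') \<in> ({0..1} \<times> {0..Y} \<times> T) \<inter> {p. Z p = 0}"
      using that y(1) by auto
    then show "\<tau> \<in> ?Bad" by force
  qed

  have on_l: "P (\<lambda>i. \<omega> i * of_real (exp (- (s * l i)))) \<noteq> 0"
    if "s > 0" "\<And>i. i < n \<Longrightarrow> cmod (\<omega> i) = 1" for s \<omega>
  proof -
    have "exp (\<i> * of_real (l i) * (\<i> * of_real s)) = of_real (exp (- (s * l i)))" for i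
      by (simp add: exp_of_real[symmetric] mult_ac)
    then show ?thesis
      using P_nonzero_on_l_torus[of \<omega> "\<i> * of_real s"] that by simp
  qed

  have "closed {\<tau> \<in> {0..1}. good \<tau>}"
    unfolding closed_sequential_limits
  proof (intro allI impI, elim conjE)
    fix \<tau> :: "nat \<Rightarrow> real" and \<tau>'
    assume \<tau>: "\<forall>k. \<tau> k \<in> {\<tau> \<in> {0..1}. good \<tau>}" and lim: "\<tau> \<longlonglongrightarrow> \<tau>'"
    have \<tau>': "\<tau>' \<in> {0..1}"
      by (rule closed_sequentially[OF closed_atLeastAtMost _ lim]) (use \<tau> in auto)
    have "Z (\<tau>', y, \<omega>) \<noteq> 0" if "y \<ge> 0" and \<omega>: "\<And>i. i < n \<Longrightarrow> cmod (\<omega> i) = 1" for y \<omega>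
    \<comment> \<open>The base torus \<open>y = 0\<close> lies on the boundary of the half-plane
      used for Hurwitz and is covered by \<open>on_l\<close>.\<close>
    proof (cases "y = 0")
      case True
      then show ?thesis using on_l[OF \<open>\<epsilon> > 0\<close> \<omega>] by (simp add: Z_def)
    next
      case False
      show ?thesis
        unfolding Z_iy P_exp
      proof (rule exp_sum_Hurwitz[where S = "{x. Im x > 0}" and y = "\<i> * of_real Y"
            and d = "\<lambda>_ j. c j * (\<Prod>i<n. (\<omega> i * of_real (exp (- (\<epsilon> * l i)))) ^ a j i)"
            and \<beta> = "\<lambda>k j. \<i> * of_real (\<Sum>i<n. real (a j i) * w (\<tau> k) i)"])
        show "open {x. Im x > 0}" "connected {x. Im x > 0}"
          by (auto intro!: open_halfspace_Im_gt convex_connected convex_halfspace_Im_gt)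
        show "\<i> * of_real y \<in> {x. Im x > 0}" using that False by simp
        show "\<i> * of_real Y \<in> {x. Im x > 0}" using Y(1) by simp
        show "(\<Sum>j\<in>J. c j * (\<Prod>i<n. (\<omega> i * of_real (exp (- (\<epsilon> * l i)))) ^ a j i) *
            exp (\<i> * of_real (\<Sum>i<n. real (a j i) * w \<tau>' i) * (\<i> * of_real Y))) \<noteq> 0"
          unfolding P_exp[symmetric] Z_iy[symmetric] by (rule far) (use \<tau>' \<omega> in auto)
        show "(\<lambda>k. \<i> * of_real (\<Sum>i<n. real (a j i) * w (\<tau> k) i))
            \<longlonglongrightarrow> \<i> * of_real (\<Sum>i<n. real (a j i) * w \<tau>' i)" for j
          unfolding w_def by (intro tendsto_intros lim)
        show "(\<Sum>j\<in>J. c j * (\<Prod>i<n. (\<omega> i * of_real (exp (- (\<epsilon> * l i)))) ^ a j i) *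
            exp (\<i> * of_real (\<Sum>i<n. real (a j i) * w (\<tau> k) i) * x)) \<noteq> 0"
          if "x \<in> {x. Im x > 0}" for k x
          unfolding P_exp[symmetric] Z_exp[symmetric]
          using \<tau> that \<omega> by (auto simp: good_def norm_mult)
      qed auto
    qed
    with \<tau>' show "\<tau>' \<in> {\<tau> \<in> {0..1}. good \<tau>}" by (auto simp: good_def)
  qed
  \<comment> \<open>For \<tau> = 0 the direction is \<open>l\<close> itself, and the point lies at
    distance \<open>\<epsilon> + y\<close> along the ray of \<open>l\<close>.\<close>
  moreover have "good 0"
    unfolding good_def
  proof (intro allI impI)
    fix y :: real and \<omega> :: "nat \<Rightarrow> complex" assume "y \<ge> 0" "\<forall>i<n. cmod (\<omega> i) = 1"
    moreover have "- ((\<epsilon> + y) * l i) = - (\<epsilon> * l i) - y * l i" for i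
      by (simp add: algebra_simps)
    ultimately show "Z (0, y, \<omega>) \<noteq> 0"
      using on_l[of "\<epsilon> + y" \<omega>] \<open>\<epsilon> > 0\<close> by (simp only: Z_def w_def prod.case) simp
  qed
  \<comment> \<open>Good and bad parameters form two disjoint closed sets covering the connected
    interval, and 0 is good.\<close>
  ultimately have "closed {\<tau> \<in> {0..1}. good \<tau>}" "{\<tau> \<in> {0..1}. good \<tau>} \<inter> {0..1} \<noteq> {}"
    by (auto intro: exI[of _ 0])
  moreover have "{\<tau> \<in> {0..1}. good \<tau>} \<inter> ?Bad \<inter> {0..1} = {}"
    "{0..1} \<subseteq> {\<tau> \<in> {0..1}. good \<tau>} \<union> ?Bad"
    using bad_iff by blast+
  ultimately have "?Bad \<inter> {0..1} = {}"
    using connected_closedD[OF connected_Icc _ _ _ closed_bad] by blast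
  then have "good 1" using bad_iff[of 1] by auto
  then show ?thesis using \<open>y \<ge> 0\<close> \<omega> by (simp add: good_def Z_def w_def)
qed

text \<open>If no coordinate is zero, the vector \<open>u\<close> of the
  \<open>- ln (cmod (z i))\<close> is reached from the base point \<open>\<epsilon> * l\<close> in
  direction \<open>u - \<epsilon> * l\<close> at \<open>y = 1\<close>. A zero coordinate kills every
  monomial but the constant one.\<close>

lemma P_nonzero_polydisc:
  assumes z: "\<And>i. i < n \<Longrightarrow> cmod (z i) < 1"
  shows "P z \<noteq> 0"
proof (cases "\<forall>i<n. z i \<noteq> 0")
  case True
  define u where "u = (\<lambda>i. - ln (cmod (z i)))"
  have u: "u i > 0" if "i < n" for i using z True that by (simp add: u_def)
  \<comment> \<open>Halving the minimum makes all entries of the direction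
    \<open>u - \<epsilon> * l\<close> strictly positive.\<close>
  define \<epsilon> where "\<epsilon> = Min ((\<lambda>i. u i / l i) ` {..<n}) / 2"
  have Min_pos: "Min ((\<lambda>i. u i / l i) ` {..<n}) > 0"
    using u l_pos n_pos by (subst Min_gr_iff) auto
  have "\<epsilon> > 0" using Min_pos by (simp add: \<epsilon>_def)
  have \<epsilon>: "\<epsilon> * l i < u i" if "i < n" for i
  proof -
    have "\<epsilon> < Min ((\<lambda>i. u i / l i) ` {..<n})" using Min_pos by (simp add: \<epsilon>_def)
    also have "\<dots> \<le> u i / l i" using that by (intro Min_le) auto
    finally show ?thesis using l_pos[OF that] by (simp add: field_simps)
  qed
  have "P z = P (\<lambda>i. sgn (z i) * of_real (exp (- (\<epsilon> * l i) - 1 * (u i - \<epsilon> * l i))))"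
  proof (rule P_cong)
    fix i assume "i < n"
    with True show "z i = sgn (z i) * of_real (exp (- (\<epsilon> * l i) - 1 * (u i - \<epsilon> * l i)))"
      by (simp add: u_def sgn_eq)
  qed
  also have "\<dots> \<noteq> 0"
    by (rule P_nonzero_direction) (use \<epsilon> \<open>\<epsilon> > 0\<close> True in \<open>auto simp: norm_sgn\<close>)
  finally show ?thesis .
next
  case False
  then obtain i where i: "i < n" "z i = 0" by blast
  have zero: "(\<Prod>i<n. z i ^ a j i) = 0" if "j \<in> J - {j0}" for j
    using i a_pos[OF that i(1)] by (intro prod_zero) (auto intro!: bexI[of _ i])
  have "(\<Sum>j\<in>J - {j0}. c j * (\<Prod>i<n. z i ^ a j i)) = 0"
    by (intro sum.neutral ballI) (simp only: zero mult_zero_right)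
  then have "P z = c j0"
    using J by (simp add: P_def sum.remove a_j0)
  with c show ?thesis by simp
qed

end

section \<open>The Lee--Yang polynomial\<close>

text \<open>Exponent vectors that differ below \<open>n\<close> keep the monomials from merging, so
  the keys of \<open>p\<close> correspond to \<open>J\<close> with unchanged coefficients.\<close>

lemma cmpoly_of_monomials:
  fixes c :: "'a \<Rightarrow> complex" and a :: "'a \<Rightarrow> nat \<Rightarrow> nat"
  assumes J: "finite J" and c: "\<And>j. j \<in> J \<Longrightarrow> c j \<noteq> 0"
    and inj: "\<And>j k. j \<in> J \<Longrightarrow> k \<in> J \<Longrightarrow> (\<And>i. i < n \<Longrightarrow> a j i = a k i) \<Longrightarrow> j = k"
  obtains p where "p \<in> cmpolys n" "\<And>z. cmpoly_eval p z = (\<Sum>j\<in>J. c j * (\<Prod>i<n. z i ^ a j i))"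
proof -
  define m :: "'a \<Rightarrow> (nat \<Rightarrow>\<^sub>0 nat)" where "m = (\<lambda>j. Abs_poly_mapping (\<lambda>i. if i < n then a j i else 0))"
  have lookup_m: "Poly_Mapping.lookup (m j) i = (if i < n then a j i else 0)" for i j
    unfolding m_def by (subst lookup_Abs_poly_mapping) auto
  have inj_m: "inj_on m J"
  proof (rule inj_onI)
    fix j k assume jk: "j \<in> J" "k \<in> J" "m j = m k"
    show "j = k"
    proof (rule inj[OF jk(1,2)])
      show "a j i = a k i" if "i < n" for i
        using lookup_m[of j i] lookup_m[of k i] jk(3) that by simp
    qed
  qed
  define p where "p = (\<Sum>j\<in>J. Poly_Mapping.single (m j) (c j))"
  have lookup_p: "Poly_Mapping.lookup p x = (\<Sum>j\<in>J. if m j = x then c j else 0)" for x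
    unfolding p_def lookup_sum lookup_single when_def ..
  have lookup_p_m: "Poly_Mapping.lookup p (m j) = c j" if "j \<in> J" for j
  proof -
    have "(\<Sum>k\<in>J. if m k = m j then c k else 0) = (\<Sum>k\<in>J. if k = j then c k else 0)"
      using inj_m that by (intro sum.cong) (auto dest: inj_onD)
    with J that show ?thesis by (simp add: lookup_p)
  qed
  have keys_p: "Poly_Mapping.keys p = m ` J"
  proof (intro equalityI subsetI)
    fix x assume "x \<in> Poly_Mapping.keys p"
    then have "Poly_Mapping.lookup p x \<noteq> 0" by (simp add: in_keys_iff)
    then obtain j where "j \<in> J" "(if m j = x then c j else 0) \<noteq> 0"
      unfolding lookup_p by (rule sum.not_neutral_contains_not_neutral)
    then show "x \<in> m ` J" by (auto split: if_splits)
  qed (auto simp: in_keys_iff lookup_p_m c)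
  have keys_m: "Poly_Mapping.keys (m j) \<subseteq> {..<n}" for j
    by (auto simp: in_keys_iff lookup_m split: if_splits)
  show thesis
  proof
    show "p \<in> cmpolys n" using keys_m by (auto simp: cmpolys_def keys_p)
    fix z :: "nat \<Rightarrow> complex"
    have "(\<Prod>i\<in>Poly_Mapping.keys (m j). z i ^ Poly_Mapping.lookup (m j) i) = (\<Prod>i<n. z i ^ a j i)" for j
      by (rule prod.mono_neutral_cong_left) (use keys_m in \<open>auto simp: lookup_m in_keys_iff\<close>)
    then show "cmpoly_eval p z = (\<Sum>j\<in>J. c j * (\<Prod>i<n. z i ^ a j i))"
      unfolding cmpoly_eval_def keys_p sum.reindex[OF inj_m] by (simp add: lookup_p_m)
  qed
qed

theorem theorem1p1:
  fixes s n :: nat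
    and c lam :: "nat \<Rightarrow> complex"
    and f :: "complex \<Rightarrow> complex"
  assumes f_eq: "\<And>x. f x = (\<Sum>j\<le>s. c j * exp (lam j * x))"
    and c_nonzero: "\<And>j. j \<le> s \<Longrightarrow> c j \<noteq> 0"
    and lam_distinct: "inj_on lam {..s}"
    and lam0_min: "\<And>j. j \<le> s \<Longrightarrow> Im (lam 0) \<le> Im (lam j)"
    and n_eq: "n = rat_real.dim ((\<lambda>j. Im (lam j - lam 0)) ` {1..s})"
    and f_real_rooted: "real_rooted f"
  shows "\<exists>(p :: cmpoly) (l :: nat \<Rightarrow> real).
           lee_yang n p \<and>
           (\<forall>i<n. l i > 0) \<and>
           inj_on l {..<n} \<and> rat_real.independent (l ` {..<n}) \<and>
           (\<forall>x. f x = exp (lam 0 * x) *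
                  cmpoly_eval p (\<lambda>i. exp (\<i> * x * complex_of_real (l i))))"
proof (cases "s = 0")
  \<comment> \<open>A single exponential: the span is zero, so \<open>n = 0\<close> and
    \<open>p\<close> is the constant \<open>c 0\<close>. The locale assumes
    \<open>n > 0\<close>.\<close>
  case True
  have "n \<le> 0" unfolding n_eq using rat_real.dim_le_card'[of "{}"] True by simp
  obtain p where p: "p \<in> cmpolys 0" "\<And>z. cmpoly_eval p z = c 0"
    using cmpoly_of_monomials[of "{0}" c 0 "\<lambda>_ _. 0"] c_nonzero[of 0] by auto
  have "lee_yang n p"
    using p c_nonzero[of 0] \<open>n \<le> 0\<close> by (auto simp: lee_yang_def)
  moreover have "f x = exp (lam 0 * x) * cmpoly_eval p (\<lambda>i. exp (\<i> * x * complex_of_real 1))" for x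
    using True by (simp add: f_eq p)
  ultimately show ?thesis
    using \<open>n \<le> 0\<close> rat_real.independent_empty
    by (intro exI[of _ p] exI[of _ "\<lambda>_. 1"]) simp
next
  case False
  define \<mu> where "\<mu> = (\<lambda>j. Im (lam j - lam 0))"
  have f_nz: "f x \<noteq> 0" if "Im x \<noteq> 0" for x
    using f_real_rooted that by (auto simp: real_rooted_def)
  have Re_lam: "Re (lam j) = Re (lam 0)" if "j \<le> s" for j
  proof (rule Re_eq_if_exp_sum_nonzero_upper[where J = "{..s}" and c = c])
    show "(\<Sum>j\<le>s. c j * exp (lam j * x)) \<noteq> 0" if "Im x > 0" for x
      using f_nz[of x] that by (simp add: f_eq)
  qed (use that c_nonzero lam_distinct lam0_min in auto)
  have lam_eq: "lam j = lam 0 + \<i> * of_real (\<mu> j)" if "j \<le> s" for j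
    using Re_lam[OF that] by (simp add: \<mu>_def complex_eq_iff)
  have inj_\<mu>: "inj_on \<mu> {..s}"
  proof (rule inj_onI)
    fix j k assume jk: "j \<in> {..s}" "k \<in> {..s}" "\<mu> j = \<mu> k"
    then have "lam j = lam k" using lam_eq[of j] lam_eq[of k] by simp
    with lam_distinct jk show "j = k" by (auto dest: inj_onD)
  qed
  have \<mu>_pos: "\<mu> j > 0" if "j \<in> {1..s}" for j
  proof -
    have "\<mu> j \<noteq> \<mu> 0" using inj_\<mu> that by (auto dest: inj_onD)
    moreover have "\<mu> j \<ge> 0" "\<mu> 0 = 0" using lam0_min that by (auto simp: \<mu>_def)
    ultimately show ?thesis by linarith
  qed
  have f_\<mu>: "f x = exp (lam 0 * x) * (\<Sum>j\<le>s. c j * exp (\<i> * of_real (\<mu> j) * x))" for x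
    unfolding f_eq sum_distrib_left
  proof (intro sum.cong)
    fix j assume "j \<in> {..s}"
    then have "lam j * x = lam 0 * x + \<i> * of_real (\<mu> j) * x"
      by (subst lam_eq) (simp_all add: ring_distribs)
    then show "c j * exp (lam j * x) = exp (lam 0 * x) * (c j * exp (\<i> * of_real (\<mu> j) * x))"
      by (simp add: exp_add)
  qed simp
  have \<mu>_nz: "(\<Sum>j\<le>s. c j * exp (\<i> * of_real (\<mu> j) * x)) \<noteq> 0" if "Im x \<noteq> 0" for x
    using f_nz[OF that] by (simp add: f_\<mu>)

  have "Max (\<mu> ` {..s}) \<in> \<mu> ` {..s}" by (intro Max_in) auto
  then obtain K where K: "K \<le> s" "\<mu> K = Max (\<mu> ` {..s})" by fastforce
  have \<mu>_less: "\<mu> j < \<mu> K" if "j \<le> s" "j \<noteq> K" for j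
  proof -
    have "\<mu> j \<le> \<mu> K" unfolding K(2) using that by (intro Max_ge) auto
    moreover have "\<mu> j \<noteq> \<mu> K" using inj_\<mu> that K(1) by (auto dest: inj_onD)
    ultimately show ?thesis by simp
  qed
  have \<mu>_0: "\<mu> 0 = 0" by (simp add: \<mu>_def)
  have "K \<noteq> 0"
    using \<mu>_less[of 1] \<mu>_pos[of 1] \<mu>_0 False by (cases "K = 0") auto

  \<comment> \<open>The differences are included so that the exponents \<open>a K i - a j i\<close>
    of the reversed polynomial are positive too. They lie in the span of the \<open>\<mu> j\<close>,
    so the dimension is still \<open>n\<close>.\<close>
  define M where "M = \<mu> ` {1..s} \<union> (\<lambda>j. \<mu> K - \<mu> j) ` ({..s} - {K})"
  have "rat_real.span M = rat_real.span (\<mu> ` {1..s})"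
    unfolding rat_real.span_eq
  proof
    have "\<mu> j \<in> rat_real.span (\<mu> ` {1..s})" if "j \<le> s" for j
    proof (cases "j = 0")
      case True
      with \<mu>_0 rat_real.span_zero show ?thesis by simp
    next
      case False
      with that have "\<mu> j \<in> \<mu> ` {1..s}" by simp
      then show ?thesis by (rule rat_real.span_base)
    qed
    then show "M \<subseteq> rat_real.span (\<mu> ` {1..s})"
      unfolding M_def using K(1) by (intro Un_least image_subsetI rat_real.span_diff) simp_all
    show "\<mu> ` {1..s} \<subseteq> rat_real.span M"
      unfolding M_def by (rule order_trans[OF Un_upper1 rat_real.span_superset])
  qed
  then have "rat_real.dim M = rat_real.dim (\<mu> ` {1..s})"
    by (rule rat_real.span_eq_dim)
  then have n_M: "n = rat_real.dim M"
    by (simp only: n_eq \<mu>_def)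
  have "finite M" by (simp add: M_def)
  have M_pos: "m > 0" if "m \<in> M" for m
    using that by (auto simp: M_def intro: \<mu>_pos \<mu>_less)
  obtain l :: "nat \<Rightarrow> real" and \<alpha> :: "real \<Rightarrow> nat \<Rightarrow> nat" where
    l_pos: "\<And>i. i < n \<Longrightarrow> l i > 0" and l: "inj_on l {..<n}" "rat_real.independent (l ` {..<n})" and
    \<alpha>_pos: "\<And>m i. m \<in> M \<Longrightarrow> i < n \<Longrightarrow> \<alpha> m i > 0" and
    \<alpha>: "\<And>m. m \<in> M \<Longrightarrow> m = (\<Sum>i<n. real (\<alpha> m i) * l i)"
    by (rule exists_rat_basis_positive_coords[of M n, OF \<open>finite M\<close> M_pos n_M]) (assumption, rule that)

  \<comment> \<open>\<open>\<mu> 0 = 0\<close> is not in \<open>M\<close>, whose elements are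
    positive, so its coordinates are set to 0 by hand.\<close>
  define a where "a = (\<lambda>j i. if j = 0 then 0 else \<alpha> (\<mu> j) i)"
  have a: "(\<Sum>i<n. real (a j i) * l i) = \<mu> j" if "j \<le> s" for j
  proof (cases "j = 0")
    case False
    then have "\<mu> j \<in> M" using that by (auto simp: M_def)
    from \<alpha>[OF this, symmetric] False show ?thesis by (simp add: a_def)
  qed (simp add: a_def \<mu>_def)
  have "n > 0"
    using a[of 1] \<mu>_pos[of 1] False by (cases n) auto
  have a_pos: "a j i > 0" if "j \<in> {..s} - {0}" "i < n" for j i
    using \<alpha>_pos[of "\<mu> j" i] that by (auto simp: a_def M_def)
  \<comment> \<open>Coordinates in the basis \<open>l\<close> are unique, so
    \<open>\<mu> K = (\<mu> K - \<mu> j) + \<mu> j\<close> adds up coordinatewise, and the first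
    summand has positive coordinates.\<close>
  have a_less: "a j i < a K i" if j: "j \<in> {..s} - {K}" and "i < n" for j i
  proof -
    define d where "d = \<alpha> (\<mu> K - \<mu> j)"
    have M: "\<mu> K - \<mu> j \<in> M" using j by (auto simp: M_def)
    have "(\<Sum>i<n. of_rat (of_nat (d i) + of_nat (a j i) - of_nat (a K i)) * l i)
        = (\<Sum>i<n. real (d i) * l i) + (\<Sum>i<n. real (a j i) * l i) - (\<Sum>i<n. real (a K i) * l i)"
      by (simp add: of_rat_add of_rat_diff ring_distribs sum.distrib sum_subtractf)
    also have "\<dots> = 0"
      using \<alpha>[OF M, symmetric] a[of j] a[OF K(1)] j by (simp add: d_def)
    finally have "(of_nat (d i) + of_nat (a j i) - of_nat (a K i) :: rat) = 0"
      using \<open>i < n\<close> by (rule rat_independent_coeffs[OF l])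
    then have "d i + a j i = a K i"
      by (metis eq_iff_diff_eq_0 of_nat_add of_nat_eq_iff)
    moreover have "d i > 0" unfolding d_def by (rule \<alpha>_pos[OF M \<open>i < n\<close>])
    ultimately show ?thesis by simp
  qed
  have a_le: "a j i \<le> a K i" if "j \<le> s" "i < n" for j i
    using a_less[of j i] that by (cases "j = K") auto

  obtain p where p: "p \<in> cmpolys n" "\<And>z. cmpoly_eval p z = (\<Sum>j\<le>s. c j * (\<Prod>i<n. z i ^ a j i))"
  proof (rule cmpoly_of_monomials[of "{..s}" c n a])
    show "j = k" if "j \<in> {..s}" "k \<in> {..s}" "\<And>i. i < n \<Longrightarrow> a j i = a k i" for j k
    proof -
      have "\<mu> j = \<mu> k" using a[of j] a[of k] that by simp
      with inj_\<mu> that show ?thesis by (auto dest: inj_onD)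
    qed
  qed (use c_nonzero in auto)

  interpret inside: stable_exp_sum "{..s}" 0 c a n l
  proof
    show "(\<Sum>j\<le>s. c j * exp (\<i> * of_real (\<Sum>i<n. real (a j i) * l i) * x)) \<noteq> 0" if "Im x > 0" for x
      using \<mu>_nz[of x] that by (simp add: a)
  qed (use c_nonzero \<open>n > 0\<close> a_pos l_pos l in \<open>auto simp: a_def\<close>)
  \<comment> \<open>The reversed polynomial, with the top monomial \<open>K\<close> as constant
    term; \<open>a_le\<close> makes the natural subtraction exact.\<close>
  interpret outside: stable_exp_sum "{..s}" K c "\<lambda>j i. a K i - a j i" n l
  proof
    show "(\<Sum>j\<le>s. c j * exp (\<i> * of_real (\<Sum>i<n. real (a K i - a j i) * l i) * x)) \<noteq> 0"
      if "Im x > 0" for x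
    proof -
      have diff: "(\<Sum>i<n. real (a K i - a j i) * l i) = \<mu> K - \<mu> j" if "j \<le> s" for j
      proof -
        have "(\<Sum>i<n. real (a K i - a j i) * l i)
            = (\<Sum>i<n. real (a K i) * l i) - (\<Sum>i<n. real (a j i) * l i)"
          unfolding sum_subtractf[symmetric] using a_le[OF that]
          by (intro sum.cong) (auto simp: of_nat_diff left_diff_distrib)
        with a[OF that] a[OF K(1)] show ?thesis by simp
      qed
      \<comment> \<open>Reversal replaces \<open>x\<close> by \<open>- x\<close> up to an
        exponential factor, so this instance rests on the absence of zeros in the lower
        half-plane.\<close>
      have "(\<Sum>j\<le>s. c j * exp (\<i> * of_real (\<Sum>i<n. real (a K i - a j i) * l i) * x))
          = exp (\<i> * of_real (\<mu> K) * x) * (\<Sum>j\<le>s. c j * exp (\<i> * of_real (\<mu> j) * (- x)))"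
        unfolding sum_distrib_left
      proof (rule sum.cong)
        fix j assume "j \<in> {..s}"
        then have "\<i> * of_real (\<Sum>i<n. real (a K i - a j i) * l i) * x
            = \<i> * of_real (\<mu> K) * x + \<i> * of_real (\<mu> j) * (- x)"
          by (simp only: diff atMost_iff of_real_diff) (simp add: algebra_simps)
        then show "c j * exp (\<i> * of_real (\<Sum>i<n. real (a K i - a j i) * l i) * x)
            = exp (\<i> * of_real (\<mu> K) * x) * (c j * exp (\<i> * of_real (\<mu> j) * (- x)))"
          by (simp only: exp_add mult_ac)
      qed simp
      with \<mu>_nz[of "- x"] that show ?thesis by simp
    qed
  qed (use c_nonzero K(1) \<open>n > 0\<close> a_less l_pos l in auto)

  have "lee_yang n p"
    unfolding lee_yang_def
  proof (intro conjI ballI)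
    fix \<Omega> :: "complex set" and z
    assume \<Omega>: "\<Omega> \<in> {{z. cmod z < 1}, {z. cmod z > 1}}" and z: "z \<in> {..<n} \<rightarrow>\<^sub>E \<Omega>"
    from \<Omega> consider "\<Omega> = {z. cmod z < 1}" | "\<Omega> = {z. cmod z > 1}" by blast
    then show "cmpoly_eval p z \<noteq> 0"
    proof cases
      case 1
      with z have "inside.P z \<noteq> 0" by (intro inside.P_nonzero_polydisc) auto
      then show ?thesis by (simp add: p(2) inside.P_def)
    next
      case 2
      have z_gt: "cmod (z i) > 1" if "i < n" for i using z 2 that by auto
      then have z_nz: "z i \<noteq> 0" if "i < n" for i using that by fastforce
      \<comment> \<open>Inversion maps the exterior into the polydisc, and the monomial with
        exponents \<open>a K i\<close> relating the two polynomials does not vanish there.\<close>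
      have "outside.P (\<lambda>i. inverse (z i)) \<noteq> 0"
        by (rule outside.P_nonzero_polydisc) (simp add: norm_inverse inverse_less_1_iff z_gt z_nz)
      moreover have "cmpoly_eval p z = (\<Prod>i<n. z i ^ a K i) * outside.P (\<lambda>i. inverse (z i))"
        unfolding p(2) outside.P_def sum_distrib_left
      proof (rule sum.cong)
        fix j assume "j \<in> {..s}"
        have "z i ^ a K i * inverse (z i) ^ (a K i - a j i) = z i ^ a j i" if "i < n" for i
        proof -
          have "a K i = a j i + (a K i - a j i)" using a_le[of j i] \<open>j \<in> {..s}\<close> that by simp
          then have "z i ^ a K i = z i ^ a j i * z i ^ (a K i - a j i)" by (metis power_add)
          with z_nz[OF that] show ?thesis by (simp add: power_inverse)
        qed
        then have "(\<Prod>i<n. z i ^ a j i) = (\<Prod>i<n. z i ^ a K i) * (\<Prod>i<n. inverse (z i) ^ (a K i - a j i))"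
          unfolding prod.distrib[symmetric] by simp
        then show "c j * (\<Prod>i<n. z i ^ a j i)
            = (\<Prod>i<n. z i ^ a K i) * (c j * (\<Prod>i<n. inverse (z i) ^ (a K i - a j i)))"
          by simp
      qed simp
      ultimately show ?thesis using z_nz by simp
    qed
  qed (rule p(1))
  moreover have "f x = exp (lam 0 * x) * cmpoly_eval p (\<lambda>i. exp (\<i> * x * complex_of_real (l i)))" for x
  proof -
    have "(\<Prod>i<n. exp (\<i> * x * of_real (l i)) ^ a j i) = exp (\<i> * of_real (\<mu> j) * x)" if "j \<le> s" for j
    proof -
      have "(\<Prod>i<n. exp (\<i> * x * of_real (l i)) ^ a j i) = (\<Prod>i<n. exp (\<i> * of_real (l i) * x) ^ a j i)"
        by (simp only: mult_ac)
      also have "\<dots> = exp (\<i> * of_real (\<mu> j) * x)"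
        unfolding prod_exp_power a[OF that] ..
      finally show ?thesis .
    qed
    then show ?thesis by (simp add: f_\<mu> p(2))
  qed
  ultimately show ?thesis
    using l_pos l by (intro exI[of _ p] exI[of _ l] conjI allI impI)
qed

end
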